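(* Let $N=3$ and let $(u_1,u_2,u_3)$ be the solution of the three-layered transmission problem described in the context, whose data satisfy $f_j=g_j=0$ for $t\le t_0$, $j=1,2$. Let $M\in\mathbb{N}$ with $M\ge2$, and let $T(M)=t_0+c_2^{-1}d_{1,2}M$. Let $\widetilde u_1^M,\widetilde u_2^M,\widetilde u_3^M$ be the $M$-th order additive multiple-scattering sums defined in the context. Then $$u_j(\bm x,t)=\widetilde u_j^M(\bm x,t)\quad\text{for }(\bm x,t)\in\Omega_j\times[0,T(M)],\quad j=1,2,3.$$
   Context: Geometry. $\mathbb{R}^2$ is divided into three layers $\Omega_1,\Omega_2,\Omega_3$, numbered from top to bottom, by two disjoint unbounded Lipschitz interfaces $\Gamma_1,\Gamma_2$, each a local perturbation of a flat horizontal line; $\Gamma_j$ separates $\Omega_j$ (above) from $\Omega_{j+1}$ (below). The unit normal $\bm n$ on $\Gamma_j$ points from $\Omega_{j+1}$ into $\Omega_j$. Set $d_{1,2}=\mathrm{dist}(\Gamma_1,\Gamma_2)>0$. Layer $\Omega_j$ has constant wave speed $c_j>0$ and constant density $\rho_j>0$. Write $\mathbb{R}^+=\{t\in\mathbb{R}:t>0\}$, and let $t_0>0$ be the arrival time of the incident field at the interfaces. Three-layered transmission problem: find $u_j$ on $\Omega_j\times\mathbb{R}^+$, $j=1,2,3$, with $$\partial_t^2u_j-c_j^2\Delta u_j=0\ \text{ in }\Omega_j\times\mathbb{R}^+,\qquad u_j|_{t=0}=\partial_tu_j|_{t=0}=0\ \text{ in }\Omega_j,$$ and, for $j=1,2$,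 on $\Gamma_j\times\mathbb{R}^+$, $$u_{j+1}-u_j=f_j,\qquad \rho_{j+1}^{-1}\frac{\partial u_{j+1}}{\partial\bm n}-\rho_j^{-1}\frac{\partial u_j}{\partial\bm n}=g_j.$$ The data come from a smooth incident field: for a plane wave $u^{\mathrm{inc}}$ impinging on $\Gamma_1$, $f_j=\delta_{j,1}u^{\mathrm{inc}}$ and $g_j=\delta_{j,1}\rho_1^{-1}\partial u^{\mathrm{inc}}/\partial\bm n$; for a point source $u^{\mathrm{inc}}$ located in $\Omega_{j_0}$, $f_j=(\delta_{j,j_0}-\delta_{j+1,j_0})u^{\mathrm{inc}}$ and $g_j=(\rho_j^{-1}\delta_{j,j_0}-\rho_{j+1}^{-1}\delta_{j+1,j_0})\partial u^{\mathrm{inc}}/\partial\bm n$ ($\delta$ the Kronecker delta). Two-layered problem for $\Gamma_j$ ($j=1,2$) with data $(\widetilde f,\widetilde g)$: let $\widetilde\Omega_j^{+}$ and $\widetilde\Omega_{j+1}^{-}$ be the unbounded domains lying above and below $\Gamma_j$, respectively. Find $\widetilde u_j^+$ on $\widetilde\Omega_j^+\times\mathbb{R}^+$ and $\widetilde u_{j+1}^-$ on $\widetilde\Omega_{j+1}^-\times\mathbb{R}^+$ with $$\partial_t^2\widetilde u_j^+-c_j^2\Delta\widetilde u_j^+=0\ \text{in }\widetilde\Omega_j^+\times\mathbb{R}^+,\qquad \partial_t^2\widetilde u_{j+1}^--c_{j+1}^2\Delta\widetilde u_{j+1}^-=0\ \text{in }\widetilde\Omega_{j+1}^-\times\mathbb{R}^+,$$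 $$\widetilde u_{j+1}^--\widetilde u_j^+=\widetilde f,\qquad \rho_{j+1}^{-1}\frac{\partial\widetilde u_{j+1}^-}{\partial\bm n}-\rho_j^{-1}\frac{\partial\widetilde u_j^+}{\partial\bm n}=\widetilde g\quad\text{on }\Gamma_j\times\mathbb{R}^+,$$ and zero initial values and zero initial time derivatives for both functions. Solutions of all the transmission problems above are assumed to exist, in a class in which each problem has at most one solution. Additive multiple scattering. For $m\in\mathbb{N}=\{1,2,\dots\}$ and $j=1,2$ let $(\widetilde u_{j,m}^+,\widetilde u_{j+1,m}^-)$ be the solution of the two-layered problem for $\Gamma_j$ with data $(\widetilde f_{j,m},\widetilde g_{j,m})$ given inductively by - $m=1$: $(\widetilde f_{j,1},\widetilde g_{j,1})=(f_j,g_j)$, $j=1,2$; - $m\ge2$: $(\widetilde f_{1,m},\widetilde g_{1,m})=\left(-\widetilde u_{2,m-1}^+,\ -\rho_2^{-1}\frac{\partial\widetilde u_{2,m-1}^+}{\partial\bm n}\right)$ on $\Gamma_1$, and $(\widetilde f_{2,m},\widetilde g_{2,m})=\left(\widetilde u_{2,m-1}^-,\ \rho_2^{-1}\frac{\partial\widetilde u_{2,m-1}^-}{\partial\bm n}\right)$ on $\Gamma_2$. The $M$-th order sums are $$\widetilde u_1^M=\sum_{m=1}^M\widetilde u_{1,m}^+,\qquad \widetilde u_2^M=\sum_{m=1}^M\left(\widetilde u_{2,m}^-+\widetilde u_{2,m}^+\right),\qquad \widetilde u_3^M=\sum_{m=1}^M\widetilde u_{3,m}^-,$$ each restricted to the corresponding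 layer $\Omega_j$.
   Formalization: The unspecified solution class is taken to be a linear space of classical solutions, closed under restriction to subdomains, in which each transmission problem has at most one solution on every time interval (0,T), not only on R^+. *)

theory Defs
  imports "HOL-Analysis.Analysis"
begin

text \<open>Fields are functions on space-time \<open>\<real>\<^sup>2 \<times> \<real>\<close>; time is the last component.\<close>

type_synonym plane = "real ^ 2"
type_synonym field = "plane \<times> real \<Rightarrow> real"

section \<open>Differentiation\<close>

definition dir_deriv :: "'a::euclidean_space \<Rightarrow> ('a \<Rightarrow> real) \<Rightarrow> 'a \<Rightarrow> real" where
  "dir_deriv e u p = frechet_derivative u (at p) e"

primrec C_diff_on :: "nat \<Rightarrow> 'a::euclidean_space set \<Rightarrow> ('a \<Rightarrow> real) \<Rightarrow> bool" where
  "C_diff_on 0 S u \<longleftrightarrow> continuous_on S u"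
| "C_diff_on (Suc k) S u \<longleftrightarrow>
     (\<forall>p\<in>S. u differentiable (at p)) \<and> (\<forall>e\<in>Basis. C_diff_on k S (dir_deriv e u))"

definition smooth_fun_on :: "'a::euclidean_space set \<Rightarrow> ('a \<Rightarrow> real) \<Rightarrow> bool" where
  "smooth_fun_on S u \<longleftrightarrow> (\<forall>k. C_diff_on k S u)"

definition dt2 :: "field \<Rightarrow> field" where
  "dt2 u = dir_deriv (0, 1) (dir_deriv (0, 1) u)"

definition laplacian :: "field \<Rightarrow> field" where
  "laplacian u p = (\<Sum>i\<in>UNIV. dir_deriv (axis i 1, 0) (dir_deriv (axis i 1, 0) u) p)"

section \<open>Interfaces and layers\<close>

text \<open>The set \<open>G\<close> is near \<open>p\<close> the graph of a Lipschitz function in some orthonormal frame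
  \<open>(e', e)\<close> centred at \<open>p\<close>, with \<open>A\<close> lying above the graph and \<open>B\<close> below it. The interface
  itself need not be a graph over the horizontal axis.\<close>

definition lipschitz_graph_near :: "plane set \<Rightarrow> plane set \<Rightarrow> plane set \<Rightarrow> plane \<Rightarrow> bool" where
  "lipschitz_graph_near G A B p \<longleftrightarrow>
     (\<exists>e e' r h L. \<exists>\<phi>::real \<Rightarrow> real.
        norm e = 1 \<and> norm e' = 1 \<and> e \<bullet> e' = 0 \<and> 0 < r \<and> 0 < h \<and>
        L-lipschitz_on UNIV \<phi> \<and>
        (\<forall>s y. \<bar>s\<bar> < r \<longrightarrow> \<bar>y\<bar> < h \<longrightarrow>
           (p + s *\<^sub>R e' + y *\<^sub>R e \<in> G \<longleftrightarrow> y = \<phi> s) \<and>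
           (p + s *\<^sub>R e' + y *\<^sub>R e \<in> A \<longleftrightarrow> y > \<phi> s) \<and>
           (p + s *\<^sub>R e' + y *\<^sub>R e \<in> B \<longleftrightarrow> y < \<phi> s)))"

text \<open>\<open>G\<close> is a Lipschitz interface, equal to a horizontal line outside a bounded set, with
  \<open>A\<close> the domain above it and \<open>B\<close> the domain below it.\<close>

definition lipschitz_interface :: "plane set \<Rightarrow> plane set \<Rightarrow> plane set \<Rightarrow> bool" where
  "lipschitz_interface G A B \<longleftrightarrow>
     open A \<and> connected A \<and> open B \<and> connected B \<and>
     A \<inter> B = {} \<and> A \<inter> G = {} \<and> B \<inter> G = {} \<and> A \<union> G \<union> B = UNIV \<and>
     (\<forall>p\<in>G. lipschitz_graph_near G A B p) \<and>
     (\<exists>a R. \<forall>x. norm x > R \<longrightarrow>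
        (x \<in> G \<longleftrightarrow> x $ 2 = a) \<and> (x \<in> A \<longleftrightarrow> x $ 2 > a) \<and> (x \<in> B \<longleftrightarrow> x $ 2 < a))"

text \<open>Two interfaces \<open>\<Gamma> 1\<close> (upper) and \<open>\<Gamma> 2\<close> (lower). For \<open>j = 1, 2\<close>, the sets \<open>A j\<close> and \<open>B j\<close>
  are the unbounded domains above and below \<open>\<Gamma> j\<close>.\<close>

definition three_layer_geometry ::
    "(nat \<Rightarrow> plane set) \<Rightarrow> (nat \<Rightarrow> plane set) \<Rightarrow> (nat \<Rightarrow> plane set) \<Rightarrow> bool" where
  "three_layer_geometry \<Gamma> A B \<longleftrightarrow>
     (\<forall>j\<in>{1,2}. lipschitz_interface (\<Gamma> j) (A j) (B j)) \<and>
     \<Gamma> 1 \<inter> \<Gamma> 2 = {} \<and> \<Gamma> 2 \<subseteq> B 1 \<and> \<Gamma> 1 \<subseteq> A 2"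

definition layer :: "(nat \<Rightarrow> plane set) \<Rightarrow> (nat \<Rightarrow> plane set) \<Rightarrow> nat \<Rightarrow> plane set" where
  "layer A B j = (if j = 1 then A 1 else if j = 2 then B 1 \<inter> A 2 else B 2)"

text \<open>The unit normal at a boundary point, pointing from \<open>B\<close> into \<open>A\<close>: every open cone around
  \<open>\<nu>\<close> (around \<open>-\<nu>\<close>) of opening less than a half-plane lies in \<open>A\<close> (in \<open>B\<close>) close to the vertex.
  For a Lipschitz graph this says that the graph is differentiable at \<open>x\<close>, so the
  normal exists, and is then unique, almost everywhere.\<close>

definition is_unit_normal :: "plane set \<Rightarrow> plane set \<Rightarrow> plane \<Rightarrow> plane \<Rightarrow> bool" where
  "is_unit_normal A B x \<nu> \<longleftrightarrow> norm \<nu> = 1 \<and>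
     (\<forall>\<epsilon>>0. \<exists>\<delta>>0. \<forall>y. norm (y - x) < \<delta> \<longrightarrow>
        (\<nu> \<bullet> (y - x) > \<epsilon> * norm (y - x) \<longrightarrow> y \<in> A) \<and>
        (\<nu> \<bullet> (y - x) < - \<epsilon> * norm (y - x) \<longrightarrow> y \<in> B))"

definition unit_normal :: "plane set \<Rightarrow> plane set \<Rightarrow> plane \<Rightarrow> plane" where
  "unit_normal A B x = (THE \<nu>. is_unit_normal A B x \<nu>)"

definition normal_deriv :: "(plane \<Rightarrow> plane) \<Rightarrow> field \<Rightarrow> field" where
  "normal_deriv n u = (\<lambda>(x, t). dir_deriv (n x, 0) u (x, t))"

text \<open>Vanishing one-dimensional Hausdorff measure; on a Lipschitz curve, vanishing arc length.\<close>

definition length_null :: "plane set \<Rightarrow> bool" where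
  "length_null S \<longleftrightarrow>
     (\<forall>\<epsilon>>0. \<exists>z r. (\<forall>i::nat. 0 \<le> r i) \<and> summable r \<and> (\<Sum>i. r i) < \<epsilon> \<and> S \<subseteq> (\<Union>i. cball (z i) (r i)))"

section \<open>Transmission problems\<close>

text \<open>All problems are posed on a time interval \<open>J\<close>, either \<open>{0<..}\<close> or \<open>{0<..<T}\<close>.\<close>

definition wave_solution :: "real set \<Rightarrow> plane set \<Rightarrow> real \<Rightarrow> field \<Rightarrow> bool" where
  "wave_solution J D c u \<longleftrightarrow>
     C_diff_on 2 (D \<times> J) u \<and>
     (\<forall>p\<in>D \<times> J. dt2 u p - c\<^sup>2 * laplacian u p = 0)"

definition zero_initial :: "real set \<Rightarrow> plane set \<Rightarrow> field \<Rightarrow> bool" where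
  "zero_initial J D u \<longleftrightarrow>
     continuous_on (D \<times> insert 0 J) u \<and>
     (\<forall>x\<in>D. u (x, 0) = 0 \<and>
        ((\<lambda>t. u (x, t)) has_real_derivative 0) (at 0 within {0..}))"

text \<open>Jump conditions on \<open>G\<close> for \<open>v\<close> on the adjacent upper domain \<open>Dv\<close> and \<open>w\<close> on the adjacent lower
  domain \<open>Dw\<close> (which may be smaller than the full domains \<open>A\<close>, \<open>B\<close> above and below \<open>G\<close>), with densities \<open>\<rho>v\<close>, \<open>\<rho>w\<close>. Boundary values are limits from inside the respective domain.
  A Lipschitz interface has a normal only almost everywhere, so the second condition is
  required almost everywhere; the one-sided normal derivatives are limits along the normal.\<close>

definition transmission ::
    "real set \<Rightarrow> plane set \<Rightarrow> plane set \<Rightarrow> plane set \<Rightarrow> plane set \<Rightarrow> plane set \<Rightarrow> real \<Rightarrow> real \<Rightarrow>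
     field \<Rightarrow> field \<Rightarrow> field \<Rightarrow> field \<Rightarrow> bool" where
  "transmission J G A B Dv Dw \<rho>v \<rho>w f g v w \<longleftrightarrow>
     (\<forall>t\<in>J. \<forall>x\<in>G. \<exists>a b.
        ((\<lambda>y. v (y, t)) \<longlongrightarrow> a) (at x within Dv) \<and>
        ((\<lambda>y. w (y, t)) \<longlongrightarrow> b) (at x within Dw) \<and>
        b - a = f (x, t)) \<and>
     (\<forall>t\<in>J. \<exists>N. length_null N \<and> (\<forall>x\<in>G - N. \<exists>\<nu> a b.
        is_unit_normal A B x \<nu> \<and>
        ((\<lambda>h. dir_deriv (\<nu>, 0) v (x + h *\<^sub>R \<nu>, t)) \<longlongrightarrow> a) (at_right 0) \<and>
        ((\<lambda>h. dir_deriv (\<nu>, 0) w (x + h *\<^sub>R \<nu>, t)) \<longlongrightarrow> b) (at_left 0) \<and>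
        b / \<rho>w - a / \<rho>v = g (x, t)))"

definition three_layer_solution ::
    "real set \<Rightarrow> (nat \<Rightarrow> plane set) \<Rightarrow> (nat \<Rightarrow> plane set) \<Rightarrow> (nat \<Rightarrow> plane set) \<Rightarrow>
     (nat \<Rightarrow> real) \<Rightarrow> (nat \<Rightarrow> real) \<Rightarrow> (nat \<Rightarrow> field) \<Rightarrow> (nat \<Rightarrow> field) \<Rightarrow> (nat \<Rightarrow> field) \<Rightarrow> bool" where
  "three_layer_solution J \<Gamma> A B c \<rho> f g u \<longleftrightarrow>
     (\<forall>j\<in>{1,2,3}. wave_solution J (layer A B j) (c j) (u j) \<and> zero_initial J (layer A B j) (u j)) \<and>
     (\<forall>j\<in>{1,2}. transmission J (\<Gamma> j) (A j) (B j)
        (layer A B j) (layer A B (j + 1)) (\<rho> j) (\<rho> (j + 1)) (f j) (g j) (u j) (u (j + 1)))"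

text \<open>The two-layered problem for \<open>\<Gamma> j\<close>, with \<open>v\<close> above and \<open>w\<close> below the interface.\<close>

definition two_layer_solution ::
    "real set \<Rightarrow> (nat \<Rightarrow> plane set) \<Rightarrow> (nat \<Rightarrow> plane set) \<Rightarrow> (nat \<Rightarrow> plane set) \<Rightarrow>
     (nat \<Rightarrow> real) \<Rightarrow> (nat \<Rightarrow> real) \<Rightarrow> nat \<Rightarrow> field \<Rightarrow> field \<Rightarrow> field \<Rightarrow> field \<Rightarrow> bool" where
  "two_layer_solution J \<Gamma> A B c \<rho> j f g v w \<longleftrightarrow>
     wave_solution J (A j) (c j) v \<and> zero_initial J (A j) v \<and>
     wave_solution J (B j) (c (j + 1)) w \<and> zero_initial J (B j) w \<and>
     transmission J (\<Gamma> j) (A j) (B j) (A j) (B j) (\<rho> j) (\<rho> (j + 1)) f g v w"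

section \<open>Solution classes\<close>

text \<open>A class of admissible functions assigns to each spatial domain \<open>D\<close> a linear space of
  functions on \<open>D\<close>, and is closed under restriction to smaller domains. (Functions
  are total, so restriction does not change the function.)\<close>

definition function_class :: "(plane set \<Rightarrow> field set) \<Rightarrow> bool" where
  "function_class K \<longleftrightarrow>
     (\<forall>D. (\<lambda>p. 0) \<in> K D \<and>
          (\<forall>u\<in>K D. \<forall>v\<in>K D. (\<lambda>p. u p + v p) \<in> K D) \<and>
          (\<forall>u\<in>K D. \<forall>r::real. (\<lambda>p. r * u p) \<in> K D)) \<and>
     (\<forall>D D'. D' \<subseteq> D \<longrightarrow> K D \<subseteq> K D')"

text \<open>Uniqueness is that of an evolution problem: on every interval \<open>{0<..<T}\<close> there is at most one
  solution. This contains uniqueness on \<open>{0<..}\<close>.\<close>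

definition three_layer_unique ::
    "(plane set \<Rightarrow> field set) \<Rightarrow> (nat \<Rightarrow> plane set) \<Rightarrow> (nat \<Rightarrow> plane set) \<Rightarrow> (nat \<Rightarrow> plane set) \<Rightarrow>
     (nat \<Rightarrow> real) \<Rightarrow> (nat \<Rightarrow> real) \<Rightarrow> bool" where
  "three_layer_unique K \<Gamma> A B c \<rho> \<longleftrightarrow>
     (\<forall>T>0. \<forall>f g u u'.
        (\<forall>j\<in>{1,2,3}. u j \<in> K (layer A B j) \<and> u' j \<in> K (layer A B j)) \<longrightarrow>
        three_layer_solution {0<..<T} \<Gamma> A B c \<rho> f g u \<longrightarrow>
        three_layer_solution {0<..<T} \<Gamma> A B c \<rho> f g u' \<longrightarrow>
        (\<forall>j\<in>{1,2,3}. \<forall>p\<in>layer A B j \<times> {0<..<T}. u j p = u' j p))"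

definition two_layer_unique ::
    "(plane set \<Rightarrow> field set) \<Rightarrow> (nat \<Rightarrow> plane set) \<Rightarrow> (nat \<Rightarrow> plane set) \<Rightarrow> (nat \<Rightarrow> plane set) \<Rightarrow>
     (nat \<Rightarrow> real) \<Rightarrow> (nat \<Rightarrow> real) \<Rightarrow> nat \<Rightarrow> bool" where
  "two_layer_unique K \<Gamma> A B c \<rho> j \<longleftrightarrow>
     (\<forall>T>0. \<forall>f g v w v' w'.
        v \<in> K (A j) \<longrightarrow> v' \<in> K (A j) \<longrightarrow> w \<in> K (B j) \<longrightarrow> w' \<in> K (B j) \<longrightarrow>
        two_layer_solution {0<..<T} \<Gamma> A B c \<rho> j f g v w \<longrightarrow>
        two_layer_solution {0<..<T} \<Gamma> A B c \<rho> j f g v' w' \<longrightarrow>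
        (\<forall>p\<in>A j \<times> {0<..<T}. v p = v' p) \<and> (\<forall>p\<in>B j \<times> {0<..<T}. w p = w' p))"

section \<open>Incident data\<close>

definition plane_wave_data ::
    "(nat \<Rightarrow> plane set) \<Rightarrow> (nat \<Rightarrow> plane set) \<Rightarrow> (nat \<Rightarrow> plane set) \<Rightarrow>
     (nat \<Rightarrow> real) \<Rightarrow> (nat \<Rightarrow> real) \<Rightarrow> (nat \<Rightarrow> field) \<Rightarrow> (nat \<Rightarrow> field) \<Rightarrow> bool" where
  "plane_wave_data \<Gamma> A B c \<rho> f g \<longleftrightarrow>
     (\<exists>F dir uinc.
        smooth_fun_on (UNIV :: real set) F \<and> norm dir = 1 \<and> dir $ 2 < 0 \<and>
        uinc = (\<lambda>(x, t). F (c 1 * t - dir \<bullet> x)) \<and>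
        (\<forall>j\<in>{1,2}. \<forall>p\<in>\<Gamma> j \<times> {0<..}.
           f j p = of_bool (j = 1) * uinc p \<and>
           g j p = of_bool (j = 1) * (1 / \<rho> 1) * normal_deriv (unit_normal (A j) (B j)) uinc p))"

text \<open>The field of a source located at \<open>z\<close> is only required to be a smooth solution of the
  wave equation away from \<open>z\<close>; its singularity at \<open>z\<close> is not prescribed.\<close>

definition point_source_data ::
    "(nat \<Rightarrow> plane set) \<Rightarrow> (nat \<Rightarrow> plane set) \<Rightarrow> (nat \<Rightarrow> plane set) \<Rightarrow>
     (nat \<Rightarrow> real) \<Rightarrow> (nat \<Rightarrow> real) \<Rightarrow> (nat \<Rightarrow> field) \<Rightarrow> (nat \<Rightarrow> field) \<Rightarrow> bool" where
  "point_source_data \<Gamma> A B c \<rho> f g \<longleftrightarrow>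
     (\<exists>j0\<in>{1,2,3}. \<exists>z\<in>layer A B j0. \<exists>uinc.
        smooth_fun_on ((- {z}) \<times> {0<..}) uinc \<and> wave_solution {0<..} (- {z}) (c j0) uinc \<and>
        (\<forall>j\<in>{1,2}. \<forall>p\<in>\<Gamma> j \<times> {0<..}.
           f j p = (of_bool (j = j0) - of_bool (j + 1 = j0)) * uinc p \<and>
           g j p = (of_bool (j = j0) / \<rho> j - of_bool (j + 1 = j0) / \<rho> (j + 1))
                   * normal_deriv (unit_normal (A j) (B j)) uinc p))"

section \<open>Additive multiple scattering\<close>

text \<open>The fields above and below \<open>\<Gamma> j\<close> at step \<open>m\<close> are \<open>up j m\<close> and \<open>um (j + 1) m\<close>.\<close>

definition scatter_f ::
    "(nat \<Rightarrow> field) \<Rightarrow> (nat \<Rightarrow> nat \<Rightarrow> field) \<Rightarrow> (nat \<Rightarrow> nat \<Rightarrow> field) \<Rightarrow> nat \<Rightarrow> nat \<Rightarrow> field" where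
  "scatter_f f up um j m =
     (if m = 1 then f j
      else if j = 1 then (\<lambda>p. - up 2 (m - 1) p)
      else um 2 (m - 1))"

definition scatter_g ::
    "(nat \<Rightarrow> plane set) \<Rightarrow> (nat \<Rightarrow> plane set) \<Rightarrow> (nat \<Rightarrow> real) \<Rightarrow>
     (nat \<Rightarrow> field) \<Rightarrow> (nat \<Rightarrow> nat \<Rightarrow> field) \<Rightarrow> (nat \<Rightarrow> nat \<Rightarrow> field) \<Rightarrow> nat \<Rightarrow> nat \<Rightarrow> field" where
  "scatter_g A B \<rho> g up um j m =
     (if m = 1 then g j
      else if j = 1 then (\<lambda>p. - (1 / \<rho> 2) * normal_deriv (unit_normal (A 1) (B 1)) (up 2 (m - 1)) p)
      else (\<lambda>p. (1 / \<rho> 2) * normal_deriv (unit_normal (A 2) (B 2)) (um 2 (m - 1)) p))"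

definition multiple_scattering ::
    "(plane set \<Rightarrow> field set) \<Rightarrow> (nat \<Rightarrow> plane set) \<Rightarrow> (nat \<Rightarrow> plane set) \<Rightarrow> (nat \<Rightarrow> plane set) \<Rightarrow>
     (nat \<Rightarrow> real) \<Rightarrow> (nat \<Rightarrow> real) \<Rightarrow> (nat \<Rightarrow> field) \<Rightarrow> (nat \<Rightarrow> field) \<Rightarrow>
     (nat \<Rightarrow> nat \<Rightarrow> field) \<Rightarrow> (nat \<Rightarrow> nat \<Rightarrow> field) \<Rightarrow> bool" where
  "multiple_scattering K \<Gamma> A B c \<rho> f g up um \<longleftrightarrow>
     (\<forall>m\<ge>1. \<forall>j\<in>{1,2}.
        up j m \<in> K (A j) \<and> um (j + 1) m \<in> K (B j) \<and>
        two_layer_solution {0<..} \<Gamma> A B c \<rho> j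
          (scatter_f f up um j m) (scatter_g A B \<rho> g up um j m) (up j m) (um (j + 1) m))"

definition scattering_sum ::
    "(nat \<Rightarrow> nat \<Rightarrow> field) \<Rightarrow> (nat \<Rightarrow> nat \<Rightarrow> field) \<Rightarrow> nat \<Rightarrow> nat \<Rightarrow> field" where
  "scattering_sum up um M j p =
     (if j = 1 then \<Sum>m=1..M. up 1 m p
      else if j = 2 then \<Sum>m=1..M. (um 2 m p + up 2 m p)
      else \<Sum>m=1..M. um 3 m p)"

end

theory Submission imports Defs begin

text \<open>Each scattering step solves a problem that ignores the other interface. In the middle layer add
  both step-\<open>m\<close> fields: then the jumps at the upper interface are the data of step \<open>m\<close> plus the
  Cauchy data there of \<open>up 2 m\<close>, the field emitted by the lower interface, which is regular across
  the upper one; symmetrically below. The data of step \<open>m + 1\<close> are chosen to remove exactly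
  these errors, so the sum over the steps telescopes: the sums of order \<open>M\<close> solve the three-layered
  problem on all of \<open>{0<..}\<close> up to the errors made by \<open>up 2 M\<close> and \<open>um 2 M\<close>
  (\<open>scattering_sum_solution\<close>).

  These last errors are absent before time \<open>T = t0 + M d / c\<^sub>2\<close>. A two-layered solution vanishes for
  as long as its data do, because zero is then a solution as well (\<open>two_layer_causality\<close>). A field
  in the middle medium moves with speed \<open>c\<^sub>2\<close> and must cross the distance \<open>d\<close> before it generates
  data at the other interface (\<open>wave_zero_near\<close>), so every step is delayed by \<open>d / c\<^sub>2\<close>
  (\<open>scattering_arrival_times\<close>). Uniqueness of the three-layered problem on \<open>{0<..<T}\<close> then
  identifies the sums with the solution, and the initial values and continuity in time add the
  endpoints \<open>0\<close> and \<open>T\<close>.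

  The analytic core is the finite speed of propagation for \<open>C\<^sup>2\<close> solutions of the wave equation
  (\<open>wave_vanishes_in_cone\<close>). It is proved by a space-time energy argument with a \<open>C\<^sup>1\<close> weight
  supported in a cone. The weighted energy current has compact support, so the only form of
  the divergence theorem involved is that derivatives of compactly supported functions have integral
  zero (\<open>integral_dir_deriv_compact_support\<close>).\<close>

section \<open>Directional derivatives\<close>

lemma dir_deriv_eq:
  "(u has_derivative u') (at p) \<Longrightarrow> dir_deriv e u p = u' e"
  unfolding dir_deriv_def using frechet_derivative_at by metis

lemma has_derivative_dir_deriv:
  "u differentiable (at p) \<Longrightarrow> (u has_derivative (\<lambda>e. dir_deriv e u p)) (at p)"
  unfolding dir_deriv_def by (simp add: frechet_derivative_works[symmetric])

lemma dir_deriv_cong_open: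
  assumes "open S" "p \<in> S" "\<And>q. q \<in> S \<Longrightarrow> u q = v q"
  shows "dir_deriv e u p = dir_deriv e v p"
proof -
  have "(u has_derivative D) (at p) \<longleftrightarrow> (v has_derivative D) (at p)" for D
    using assms has_derivative_transform_within_open by metis
  then show ?thesis unfolding dir_deriv_def frechet_derivative_def by simp
qed

lemma dir_deriv_zero_open:
  assumes "open S" "p \<in> S" "\<And>q. q \<in> S \<Longrightarrow> u q = 0"
  shows "dir_deriv e u p = 0"
  using dir_deriv_cong_open[OF assms(1,2), of u "\<lambda>q. 0"] assms(3)
  by (simp add: dir_deriv_eq[OF has_derivative_const])

lemma dir_deriv_add:
  assumes "u differentiable (at p)" "v differentiable (at p)"
  shows "dir_deriv e (\<lambda>q. u q + v q) p = dir_deriv e u p + dir_deriv e v p"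
  by (rule dir_deriv_eq[OF has_derivative_add[OF assms[THEN has_derivative_dir_deriv]]])

lemma dir_deriv_mult:
  fixes u v :: "'a::euclidean_space \<Rightarrow> real"
  assumes "u differentiable (at p)" "v differentiable (at p)"
  shows "dir_deriv e (\<lambda>q. u q * v q) p = u p * dir_deriv e v p + dir_deriv e u p * v p"
  by (rule dir_deriv_eq[OF has_derivative_mult[OF assms[THEN has_derivative_dir_deriv]]])

lemma dir_deriv_sum_Basis:
  assumes "u differentiable (at p)"
  shows "dir_deriv e u p = (\<Sum>b\<in>Basis. (e \<bullet> b) * dir_deriv b u p)"
proof -
  interpret bounded_linear "\<lambda>e. dir_deriv e u p"
    using has_derivative_dir_deriv[OF assms] by (rule has_derivative_bounded_linear)
  have "dir_deriv e u p = dir_deriv (\<Sum>b\<in>Basis. (e \<bullet> b) *\<^sub>R b) u p"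
    by (simp add: euclidean_representation)
  also have "\<dots> = (\<Sum>b\<in>Basis. (e \<bullet> b) * dir_deriv b u p)"
    unfolding sum by (simp add: scale)
  finally show ?thesis .
qed

section \<open>Functions of class \<open>C\<^sup>k\<close>\<close>

lemma C_diff_on_cong:
  assumes "open S" "\<And>p. p \<in> S \<Longrightarrow> u p = v p" "C_diff_on k S u"
  shows "C_diff_on k S v"
  using assms(2,3)
proof (induction k arbitrary: u v)
  case 0
  then show ?case using continuous_on_cong by force
next
  case (Suc k)
  have "v differentiable (at p)" if "p \<in> S" for p
  proof -
    have "(u has_derivative (\<lambda>e. dir_deriv e u p)) (at p)"
      using Suc.prems that by (intro has_derivative_dir_deriv) simp
    then have "(v has_derivative (\<lambda>e. dir_deriv e u p)) (at p)"
      by (rule has_derivative_transform_within_open[OF _ assms(1) that]) (rule Suc.prems)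
    then show ?thesis by (rule differentiableI)
  qed
  moreover have "C_diff_on k S (dir_deriv e v)" if "e \<in> Basis" for e
  proof (rule Suc.IH)
    show "C_diff_on k S (dir_deriv e u)" using Suc.prems that by simp
    show "dir_deriv e u p = dir_deriv e v p" if "p \<in> S" for p
      using dir_deriv_cong_open[OF assms(1) that] Suc.prems by blast
  qed
  ultimately show ?case by simp
qed

lemma C_diff_on_subset: "C_diff_on k S u \<Longrightarrow> S' \<subseteq> S \<Longrightarrow> C_diff_on k S' u"
proof (induction k arbitrary: u)
  case 0 then show ?case using continuous_on_subset[of S u S'] by simp
next
  case (Suc k) then show ?case by auto
qed

lemma C_diff_on_Suc_continuous: "C_diff_on (Suc k) S u \<Longrightarrow> continuous_on S u"
  by (intro differentiable_imp_continuous_on)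
    (auto intro: differentiable_at_withinI simp: differentiable_on_def)

lemma C_diff_on_continuous: "C_diff_on k S u \<Longrightarrow> continuous_on S u"
proof (cases k)
  case (Suc k')
  moreover assume "C_diff_on k S u"
  ultimately show ?thesis using C_diff_on_Suc_continuous[of k' S u] by simp
qed simp

lemma C_diff_on_pred: "C_diff_on (Suc k) S u \<Longrightarrow> C_diff_on k S u"
proof (induction k arbitrary: u)
  case 0 then show ?case using C_diff_on_Suc_continuous[of 0 S u] by simp
next
  case (Suc k)
  then have "\<forall>e\<in>Basis. C_diff_on (Suc k) S (dir_deriv e u)" by simp
  then show ?case using Suc by simp
qed

lemma C_diff_on_const: "C_diff_on k S (\<lambda>p. a)"
proof (induction k arbitrary: a)
  case (Suc k)
  have "dir_deriv e (\<lambda>p. a) = (\<lambda>p. 0)" for e :: 'a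
    using dir_deriv_eq[OF has_derivative_const] by blast
  then show ?case using Suc by simp
qed simp

lemma C_diff_on_add:
  assumes "open S"
  shows "C_diff_on k S u \<Longrightarrow> C_diff_on k S v \<Longrightarrow> C_diff_on k S (\<lambda>p. u p + v p)"
proof (induction k arbitrary: u v)
  case 0 then show ?case by (simp add: continuous_on_add)
next
  case (Suc k)
  have "C_diff_on k S (dir_deriv e (\<lambda>p. u p + v p))" if "e \<in> Basis" for e
  proof (rule C_diff_on_cong[OF assms])
    show "C_diff_on k S (\<lambda>p. dir_deriv e u p + dir_deriv e v p)"
      using Suc that by simp
  qed (use Suc.prems in \<open>simp add: dir_deriv_add\<close>)
  then show ?case using Suc.prems by simp
qed

lemma C_diff_on_mult:
  assumes "open S"
  shows "C_diff_on k S u \<Longrightarrow> C_diff_on k S v \<Longrightarrow> C_diff_on k S (\<lambda>p. u p * v p)"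
proof (induction k arbitrary: u v)
  case 0 then show ?case by (simp add: continuous_on_mult)
next
  case (Suc k)
  have "C_diff_on k S (dir_deriv e (\<lambda>p. u p * v p))" if "e \<in> Basis" for e
  proof (rule C_diff_on_cong[OF assms])
    show "C_diff_on k S (\<lambda>p. u p * dir_deriv e v p + dir_deriv e u p * v p)"
      using Suc that C_diff_on_pred[of k S] by (intro C_diff_on_add[OF assms] Suc.IH) auto
  qed (use Suc.prems in \<open>simp add: dir_deriv_mult\<close>)
  then show ?case using Suc.prems by simp
qed

lemma C_diff_on_sum:
  assumes "open S" "finite I" "\<And>i. i \<in> I \<Longrightarrow> C_diff_on k S (u i)"
  shows "C_diff_on k S (\<lambda>p. \<Sum>i\<in>I. u i p)"
  using assms(2,3)
  by (induction I rule: finite_induct) (auto intro: C_diff_on_add[OF assms(1)] C_diff_on_const)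

lemma continuous_on_dir_deriv:
  assumes "C_diff_on (Suc k) S u"
  shows "continuous_on S (dir_deriv e u)"
proof (rule continuous_on_eq)
  have "continuous_on S (dir_deriv b u)" if "b \<in> Basis" for b
    using assms that by (intro C_diff_on_continuous[of k]) simp
  then show "continuous_on S (\<lambda>p. \<Sum>b\<in>Basis. (e \<bullet> b) * dir_deriv b u p)"
    by (intro continuous_intros)
qed (use assms in \<open>simp add: dir_deriv_sum_Basis[symmetric]\<close>)

text \<open>Both orders of differentiation arise from the same second difference quotient, so their
  equality follows from applying the mean value theorem to it twice.\<close>

lemma second_difference_mean_value:
  assumes h: "0 < h"
    and S: "\<And>s r. 0 \<le> s \<Longrightarrow> s \<le> h \<Longrightarrow> 0 \<le> r \<Longrightarrow> r \<le> h \<Longrightarrow> p + s *\<^sub>R e1 + r *\<^sub>R e2 \<in> S"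
    and u: "\<And>q. q \<in> S \<Longrightarrow> u differentiable (at q)"
    and u1: "\<And>q. q \<in> S \<Longrightarrow> dir_deriv e1 u differentiable (at q)"
  shows "\<exists>s r. 0 < s \<and> s < h \<and> 0 < r \<and> r < h \<and>
     u (p + h *\<^sub>R e1 + h *\<^sub>R e2) - u (p + h *\<^sub>R e1) - u (p + h *\<^sub>R e2) + u p
       = h\<^sup>2 * dir_deriv e2 (dir_deriv e1 u) (p + s *\<^sub>R e1 + r *\<^sub>R e2)"
proof -
  have d1: "((\<lambda>s. u (p + s *\<^sub>R e1 + r *\<^sub>R e2)) has_real_derivative
      dir_deriv e1 u (p + s *\<^sub>R e1 + r *\<^sub>R e2)) (at s)"
    if "0 \<le> s" "s \<le> h" "0 \<le> r" "r \<le> h" for s r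
  proof -
    have "((\<lambda>s. u (p + s *\<^sub>R e1 + r *\<^sub>R e2)) has_derivative
       (\<lambda>k. dir_deriv (k *\<^sub>R e1) u (p + s *\<^sub>R e1 + r *\<^sub>R e2))) (at s)"
      by (rule has_derivative_compose[where g = u and f = "\<lambda>s. p + s *\<^sub>R e1 + r *\<^sub>R e2"])
        (auto intro!: derivative_eq_intros has_derivative_dir_deriv u S that)
    moreover have "dir_deriv (k *\<^sub>R e1) u q = dir_deriv e1 u q * k" if "u differentiable (at q)" for k q
      using linear_scale[OF has_derivative_linear[OF has_derivative_dir_deriv[OF that]], of k e1]
      by simp
    ultimately show ?thesis
      unfolding has_field_derivative_def using u[OF S[OF that]] by simp
  qed
  have d2: "((\<lambda>r. dir_deriv e1 u (p + s *\<^sub>R e1 + r *\<^sub>R e2)) has_real_derivative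
      dir_deriv e2 (dir_deriv e1 u) (p + s *\<^sub>R e1 + r *\<^sub>R e2)) (at r)"
    if "0 \<le> s" "s \<le> h" "0 \<le> r" "r \<le> h" for s r
  proof -
    have "((\<lambda>r. dir_deriv e1 u (p + s *\<^sub>R e1 + r *\<^sub>R e2)) has_derivative
       (\<lambda>k. dir_deriv (k *\<^sub>R e2) (dir_deriv e1 u) (p + s *\<^sub>R e1 + r *\<^sub>R e2))) (at r)"
      by (rule has_derivative_compose[where g = "dir_deriv e1 u" and f = "\<lambda>r. p + s *\<^sub>R e1 + r *\<^sub>R e2"])
        (auto intro!: derivative_eq_intros has_derivative_dir_deriv u1 S that)
    moreover have "dir_deriv (k *\<^sub>R e2) v q = dir_deriv e2 v q * k" if "v differentiable (at q)" for k v q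
      using linear_scale[OF has_derivative_linear[OF has_derivative_dir_deriv[OF that]], of k e2]
      by simp
    ultimately show ?thesis
      unfolding has_field_derivative_def using u1[OF S[OF that]] by simp
  qed
  have "\<exists>s>0. s < h \<and> (u (p + h *\<^sub>R e1 + h *\<^sub>R e2) - u (p + h *\<^sub>R e1 + 0 *\<^sub>R e2))
       - (u (p + 0 *\<^sub>R e1 + h *\<^sub>R e2) - u (p + 0 *\<^sub>R e1 + 0 *\<^sub>R e2))
     = (h - 0) * (dir_deriv e1 u (p + s *\<^sub>R e1 + h *\<^sub>R e2) - dir_deriv e1 u (p + s *\<^sub>R e1 + 0 *\<^sub>R e2))"
    by (rule MVT2[OF h], rule DERIV_diff) (use h d1[of _ h] d1[of _ 0] in auto)
  then obtain s where s: "0 < s" "s < h" and es: "u (p + h *\<^sub>R e1 + h *\<^sub>R e2) - u (p + h *\<^sub>R e1)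
       - u (p + h *\<^sub>R e2) + u p
     = h * (dir_deriv e1 u (p + s *\<^sub>R e1 + h *\<^sub>R e2) - dir_deriv e1 u (p + s *\<^sub>R e1 + 0 *\<^sub>R e2))"
    by auto
  have "\<exists>r>0. r < h \<and> dir_deriv e1 u (p + s *\<^sub>R e1 + h *\<^sub>R e2) - dir_deriv e1 u (p + s *\<^sub>R e1 + 0 *\<^sub>R e2)
     = (h - 0) * dir_deriv e2 (dir_deriv e1 u) (p + s *\<^sub>R e1 + r *\<^sub>R e2)"
    by (rule MVT2[OF h]) (use s d2[of s] in auto)
  then obtain r where "0 < r" "r < h"
    "dir_deriv e1 u (p + s *\<^sub>R e1 + h *\<^sub>R e2) - dir_deriv e1 u (p + s *\<^sub>R e1 + 0 *\<^sub>R e2)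
     = (h - 0) * dir_deriv e2 (dir_deriv e1 u) (p + s *\<^sub>R e1 + r *\<^sub>R e2)" by blast
  then show ?thesis using s es by (intro exI[of _ s] exI[of _ r]) (simp add: power2_eq_square)
qed

lemma dir_deriv_commute:
  assumes S: "open S" "p \<in> S" and u: "C_diff_on 2 S u" and e: "e1 \<in> Basis" "e2 \<in> Basis"
  shows "dir_deriv e2 (dir_deriv e1 u) p = dir_deriv e1 (dir_deriv e2 u) p"
proof (rule ccontr)
  let ?a = "dir_deriv e2 (dir_deriv e1 u)" and ?b = "dir_deriv e1 (dir_deriv e2 u)"
  assume "?a p \<noteq> ?b p"
  define \<epsilon> where "\<epsilon> = dist (?a p) (?b p) / 2"
  have "\<epsilon> > 0" using \<open>?a p \<noteq> ?b p\<close> by (simp add: \<epsilon>_def)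
  have C1: "C_diff_on (Suc 0) S (dir_deriv e1 u)" "C_diff_on (Suc 0) S (dir_deriv e2 u)"
    using u e unfolding numeral_2_eq_2 by auto
  have du: "u differentiable (at q)" "dir_deriv e1 u differentiable (at q)"
    "dir_deriv e2 u differentiable (at q)" if "q \<in> S" for q
    using that u C1 unfolding numeral_2_eq_2 by auto
  have "isCont ?a p" "isCont ?b p"
    using C1[THEN continuous_on_dir_deriv] S continuous_on_eq_continuous_at by blast+
  then obtain d1 d2 where d: "d1 > 0" "d2 > 0"
    "\<And>q. dist q p < d1 \<Longrightarrow> dist (?a q) (?a p) < \<epsilon>" "\<And>q. dist q p < d2 \<Longrightarrow> dist (?b q) (?b p) < \<epsilon>"
    using \<open>\<epsilon> > 0\<close> unfolding continuous_at_eps_delta by metis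
  obtain d3 where d3: "d3 > 0" "ball p d3 \<subseteq> S" using S open_contains_ball by blast
  define d where "d = min d1 (min d2 d3)"
  have "d > 0" using d d3 by (simp add: d_def)
  define h where "h = d / 4"
  have h: "h > 0" using \<open>d > 0\<close> by (simp add: h_def)
  have near: "dist (p + s *\<^sub>R e + r *\<^sub>R e') p < d"
    if "0 \<le> s" "s \<le> h" "0 \<le> r" "r \<le> h" "e \<in> Basis" "e' \<in> Basis" for s r e e'
  proof -
    have "dist (p + s *\<^sub>R e + r *\<^sub>R e') p = norm (s *\<^sub>R e + r *\<^sub>R e')"
      by (simp add: dist_norm algebra_simps)
    also have "\<dots> \<le> norm (s *\<^sub>R e) + norm (r *\<^sub>R e')" by (rule norm_triangle_ineq)
    also have "\<dots> \<le> h + h" using that by simp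
    finally show ?thesis using \<open>d > 0\<close> by (simp add: h_def)
  qed
  then have inS: "p + s *\<^sub>R e + r *\<^sub>R e' \<in> S"
    if "0 \<le> s" "s \<le> h" "0 \<le> r" "r \<le> h" "e \<in> Basis" "e' \<in> Basis" for s r e e'
    using that d3 unfolding d_def ball_def by (force simp: dist_commute)
  obtain s r where sr: "0 < s" "s < h" "0 < r" "r < h" and
    e1: "u (p + h *\<^sub>R e1 + h *\<^sub>R e2) - u (p + h *\<^sub>R e1) - u (p + h *\<^sub>R e2) + u p
       = h\<^sup>2 * ?a (p + s *\<^sub>R e1 + r *\<^sub>R e2)"
    using second_difference_mean_value[OF h, of p e1 e2 S u] inS du e by blast
  obtain s' r' where sr': "0 < s'" "s' < h" "0 < r'" "r' < h" and
    e2: "u (p + h *\<^sub>R e2 + h *\<^sub>R e1) - u (p + h *\<^sub>R e2) - u (p + h *\<^sub>R e1) + u p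
       = h\<^sup>2 * ?b (p + s' *\<^sub>R e2 + r' *\<^sub>R e1)"
    using second_difference_mean_value[OF h, of p e2 e1 S u] inS du e by blast
  have "p + h *\<^sub>R e2 + h *\<^sub>R e1 = p + h *\<^sub>R e1 + h *\<^sub>R e2" by simp
  with e1 e2 have "h\<^sup>2 * ?a (p + s *\<^sub>R e1 + r *\<^sub>R e2) = h\<^sup>2 * ?b (p + s' *\<^sub>R e2 + r' *\<^sub>R e1)"
    by (metis (no_types, opaque_lifting) add_diff_eq diff_diff_eq add.commute)
  then have eq: "?a (p + s *\<^sub>R e1 + r *\<^sub>R e2) = ?b (p + s' *\<^sub>R e2 + r' *\<^sub>R e1)"
    using h by simp
  have "dist (?a (p + s *\<^sub>R e1 + r *\<^sub>R e2)) (?a p) < \<epsilon>"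
    using near[of s r e1 e2] sr e by (intro d(3)) (simp add: d_def)
  moreover have "dist (?b (p + s' *\<^sub>R e2 + r' *\<^sub>R e1)) (?b p) < \<epsilon>"
    using near[of s' r' e2 e1] sr' e by (intro d(4)) (simp add: d_def)
  ultimately have "dist (?a p) (?b p) < 2 * \<epsilon>" unfolding eq
    using dist_triangle3[of "?a p" "?b p" "?b (p + s' *\<^sub>R e2 + r' *\<^sub>R e1)"] by linarith
  then show False by (simp add: \<epsilon>_def)
qed

section \<open>Integrals of compactly supported functions\<close>

lemma integrable_compact_support:
  fixes G :: "'a::euclidean_space \<Rightarrow> real"
  assumes "continuous_on UNIV G" "compact K" "\<And>p. p \<notin> K \<Longrightarrow> G p = 0"
  shows "integrable lborel G"
proof -
  have "integrable lborel (\<lambda>x. indicator K x *\<^sub>R G x)"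
    using assms continuous_on_subset[of UNIV G K] by (intro borel_integrable_compact) auto
  moreover have "(\<lambda>x. indicator K x *\<^sub>R G x) = G"
    using assms(3) by (force simp: indicator_def)
  ultimately show ?thesis by simp
qed

lemma integral_translation:
  fixes G :: "'a::euclidean_space \<Rightarrow> real"
  assumes "continuous_on UNIV G"
  shows "(\<integral>p. G (e + p) \<partial>lborel) = (\<integral>p. G p \<partial>lborel)"
proof -
  have "(\<integral>p. G p \<partial>lborel) = (\<integral>p. G p \<partial>distr lborel borel ((+) e))"
    by (simp add: lborel_distr_plus)
  also have "\<dots> = (\<integral>p. G (e + p) \<partial>lborel)"
    using assms by (intro integral_distr) (auto intro: borel_measurable_continuous_onI)
  finally show ?thesis by simp
qed

text \<open>Translation invariance of Lebesgue measure makes the integral of every difference quotient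
  vanish; the difference quotients converge boundedly, with supports in a common compact set.\<close>

lemma integral_dir_deriv_compact_support:
  fixes G :: "'a::euclidean_space \<Rightarrow> real"
  assumes G: "C_diff_on 1 UNIV G" and K: "compact K" "\<And>p. p \<notin> K \<Longrightarrow> G p = 0"
  shows "integrable lborel (dir_deriv e G)" "(\<integral>p. dir_deriv e G p \<partial>lborel) = 0"
proof -
  let ?G' = "dir_deriv e G"
  have cont: "continuous_on UNIV G" "continuous_on UNIV ?G'"
    using C_diff_on_continuous[OF G] continuous_on_dir_deriv[of 0 UNIV G] G by auto
  have G'0: "?G' p = 0" if "p \<notin> K" for p
    using that K by (intro dir_deriv_zero_open[of "- K"]) (auto simp: compact_imp_closed)
  show int: "integrable lborel ?G'"
    using cont(2) K(1) G'0 by (rule integrable_compact_support)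
  have "bounded (?G' ` K)"
    using K(1) cont(2) continuous_on_subset compact_continuous_image compact_imp_bounded
    by (metis subset_UNIV)
  then obtain C where C: "C > 0" "\<And>p. p \<in> K \<Longrightarrow> \<bar>?G' p\<bar> \<le> C"
    unfolding bounded_pos by auto
  have bound: "\<bar>?G' p\<bar> \<le> C" for p
    using C G'0[of p] by (cases "p \<in> K") auto
  define K' where "K' = (\<lambda>(p, t). p - t *\<^sub>R e) ` (K \<times> {0..1::real})"
  have K': "compact K'" unfolding K'_def split_def
    using K(1) by (intro compact_continuous_image continuous_intros compact_Times) auto
  define h where "h n = 1 / (real n + 1)" for n
  have h: "0 < h n" "h n \<le> 1" for n by (auto simp: h_def)
  define s where "s n p = (G (h n *\<^sub>R e + p) - G p) / h n" for n p
  have deriv: "((\<lambda>t. G (t *\<^sub>R e + p)) has_real_derivative ?G' (t *\<^sub>R e + p)) (at t)" for t p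
  proof -
    have dG: "(G has_derivative (\<lambda>v. dir_deriv v G q)) (at q)" for q
      using G by (intro has_derivative_dir_deriv) auto
    have "((\<lambda>t. G (t *\<^sub>R e + p)) has_derivative (\<lambda>k. dir_deriv (k *\<^sub>R e) G (t *\<^sub>R e + p))) (at t)"
      by (rule has_derivative_compose[where g = G and f = "\<lambda>t. t *\<^sub>R e + p"])
        (auto intro!: derivative_eq_intros dG)
    moreover have "dir_deriv (k *\<^sub>R e) G q = ?G' q * k" for k q
      using linear_scale[OF has_derivative_linear[OF dG], of k e] by simp
    ultimately show ?thesis unfolding has_field_derivative_def by simp
  qed
  have lim: "(\<lambda>n. s n p) \<longlonglongrightarrow> ?G' p" for p
  proof -
    have "(\<lambda>t. (G (t *\<^sub>R e + p) - G p) / t) \<midarrow>0\<rightarrow> ?G' p"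
      using deriv[of p 0] by (simp add: has_field_derivative_iff)
    moreover have "h \<longlonglongrightarrow> 0" using LIMSEQ_inverse_real_of_nat
      by (simp add: h_def[abs_def] inverse_eq_divide add.commute)
    ultimately have "(\<lambda>n. (G (h n *\<^sub>R e + p) - G p) / h n) \<longlonglongrightarrow> ?G' p"
      using h(1) by (intro filterlim_compose[of "\<lambda>t. (G (t *\<^sub>R e + p) - G p) / t" _ "at 0" h])
        (auto simp: filterlim_at less_imp_neq[symmetric])
    then show ?thesis by (simp add: s_def)
  qed
  have dom: "norm (s n p) \<le> C * indicator K' p" for n p
  proof (cases "p \<in> K'")
    case True
    have "\<exists>z>0. z < h n \<and> G (h n *\<^sub>R e + p) - G (0 *\<^sub>R e + p) = (h n - 0) * ?G' (z *\<^sub>R e + p)"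
      by (rule MVT2) (use h deriv in auto)
    then show ?thesis using True bound h(1)[of n] by (auto simp: s_def abs_mult)
  next
    case False
    have "h n *\<^sub>R e + p \<notin> K" "p \<notin> K"
    proof -
      have "h n *\<^sub>R e + p \<in> K \<Longrightarrow> p \<in> K'"
        unfolding K'_def using h[of n]
        by (intro image_eqI[of _ _ "(h n *\<^sub>R e + p, h n)"]) auto
      moreover have "p \<in> K \<Longrightarrow> p \<in> K'"
        unfolding K'_def by (intro image_eqI[of _ _ "(p, 0)"]) auto
      ultimately show "h n *\<^sub>R e + p \<notin> K" "p \<notin> K" using False by auto
    qed
    then show ?thesis using False K(2) by (simp add: s_def)
  qed
  have meas: "s n \<in> borel_measurable lborel" for n
  proof -
    have "continuous_on UNIV (s n)" unfolding s_def using h(1)[of n]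
      by (intro continuous_intros continuous_on_compose2[OF cont(1)]) auto
    then show ?thesis by (simp add: borel_measurable_continuous_onI)
  qed
  have "integrable lborel (\<lambda>p. C * indicator K' p)"
    using K' by (intro integrable_mult_right integrable_real_indicator)
      (auto simp: compact_imp_closed borel_closed emeasure_bounded_finite[OF compact_imp_bounded, simplified])
  then have "(\<lambda>n. \<integral>p. s n p \<partial>lborel) \<longlonglongrightarrow> (\<integral>p. ?G' p \<partial>lborel)"
    using lim dom meas cont(2)
    by (intro integral_dominated_convergence[where w = "\<lambda>p. C * indicator K' p"])
      (auto intro: borel_measurable_continuous_onI)
  moreover have "(\<integral>p. s n p \<partial>lborel) = 0" for n
  proof -
    have iG: "integrable lborel G" using cont(1) K by (rule integrable_compact_support)
    have "continuous_on UNIV (\<lambda>p. G (h n *\<^sub>R e + p))"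
      by (intro continuous_on_compose2[OF cont(1)] continuous_intros) auto
    moreover have "compact ((\<lambda>p. p - h n *\<^sub>R e) ` K)"
      using K(1) by (intro compact_continuous_image continuous_intros)
    moreover have "G (h n *\<^sub>R e + p) = 0" if "p \<notin> (\<lambda>p. p - h n *\<^sub>R e) ` K" for p
      using that by (intro K(2)) (auto simp: image_iff algebra_simps)
    ultimately have "integrable lborel (\<lambda>p. G (h n *\<^sub>R e + p))"
      by (rule integrable_compact_support)
    then show ?thesis unfolding s_def
      using iG integral_translation[OF cont(1), of "h n *\<^sub>R e"] by simp
  qed
  ultimately show "(\<integral>p. ?G' p \<partial>lborel) = 0"
    using LIMSEQ_unique[of "\<lambda>n. 0::real"] by simp
qed

lemma continuous_nonneg_integral_zero:
  fixes I :: "'a::euclidean_space \<Rightarrow> real"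
  assumes "continuous_on UNIV I" "integrable lborel I" "\<And>p. 0 \<le> I p" "(\<integral>p. I p \<partial>lborel) = 0"
  shows "I p = 0"
proof -
  have "AE p in lborel. I p = 0"
    using integral_nonneg_eq_0_iff_AE[OF assms(2)] assms by simp
  moreover have "{p \<in> space lborel. I p \<noteq> 0} = {p. I p \<noteq> 0}" by simp
  moreover have op: "open {p. I p \<noteq> 0}"
    using open_vimage[of "- {0}" I] assms(1)
    by (simp add: vimage_def continuous_on_eq_continuous_at open_Compl)
  ultimately have "{p. I p \<noteq> 0} \<in> null_sets lborel"
    using AE_iff_null_sets[of "{p. I p \<noteq> 0}" lborel] by (simp add: borel_open)
  then have "negligible {p. I p \<noteq> 0}"
    by (simp add: negligible_iff_null_sets null_sets_completionI)
  then have "{p. I p \<noteq> 0} = {}" using op open_not_negligible by blast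
  then show ?thesis by blast
qed

lemma C_diff_on_Un:
  assumes "open S" "open S'"
  shows "C_diff_on k S u \<Longrightarrow> C_diff_on k S' u \<Longrightarrow> C_diff_on k (S \<union> S') u"
  by (induction k arbitrary: u) (auto intro: continuous_on_open_Un assms)

text \<open>This turns a weighted current that lives on the space-time domain of a wave into
  a function on the whole space, to which the integral identity applies.\<close>

lemma C_diff_on_extend_zero:
  assumes "open U" "C_diff_on k U X" "closed K" "K \<subseteq> U" "\<And>p. p \<in> U - K \<Longrightarrow> X p = 0"
  shows "C_diff_on k UNIV (\<lambda>p. if p \<in> U then X p else 0)"
proof -
  have "C_diff_on k U (\<lambda>p. if p \<in> U then X p else 0)"
    by (rule C_diff_on_cong[OF assms(1) _ assms(2)]) simp
  moreover have "C_diff_on k (- K) (\<lambda>p. if p \<in> U then X p else 0)"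
    by (rule C_diff_on_cong[OF _ _ C_diff_on_const[of _ _ 0]]) (use assms in auto)
  moreover have "U \<union> - K = UNIV" using assms(4) by auto
  ultimately show ?thesis using C_diff_on_Un[of U "- K"] assms(1,3) by auto
qed

section \<open>Finite speed of propagation\<close>

text \<open>The energy flux is at most \<open>c\<close> times the energy density (Cauchy--Schwarz and the inequality
  between the arithmetic and the geometric mean). A slope \<open>norm \<beta> < 1\<close> makes the estimate strict
  wherever the time derivative \<open>a\<close> does not vanish.\<close>

lemma energy_flux_bound:
  fixes a c :: real and \<beta> b :: plane
  assumes "c > 0" "norm \<beta> < 1"
  shows "c\<^sup>2 * a * (\<beta> \<bullet> b) \<le> c * ((a\<^sup>2 + c\<^sup>2 * (b \<bullet> b)) / 2)"
    and "a \<noteq> 0 \<Longrightarrow> c\<^sup>2 * a * (\<beta> \<bullet> b) < c * ((a\<^sup>2 + c\<^sup>2 * (b \<bullet> b)) / 2)"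
proof -
  define k where "k = norm \<beta>"
  define E where "E = (a\<^sup>2 + c\<^sup>2 * (b \<bullet> b)) / 2"
  have E: "E \<ge> 0" "a \<noteq> 0 \<Longrightarrow> E > 0"
    by (auto simp: E_def add_pos_nonneg)
  have amgm: "\<bar>a\<bar> * (c * norm b) \<le> E"
    using sum_squares_bound[of "\<bar>a\<bar>" "c * norm b"]
    by (simp add: E_def power_mult_distrib power2_norm_eq_inner)
  have "c\<^sup>2 * a * (\<beta> \<bullet> b) \<le> c\<^sup>2 * \<bar>a\<bar> * (k * norm b)"
  proof -
    have "a * (\<beta> \<bullet> b) \<le> \<bar>a\<bar> * \<bar>\<beta> \<bullet> b\<bar>" by (metis abs_ge_self abs_mult)
    also have "\<dots> \<le> \<bar>a\<bar> * (k * norm b)"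
      unfolding k_def by (intro mult_left_mono Cauchy_Schwarz_ineq2) auto
    finally have "c\<^sup>2 * (a * (\<beta> \<bullet> b)) \<le> c\<^sup>2 * (\<bar>a\<bar> * (k * norm b))"
      by (intro mult_left_mono) auto
    then show ?thesis by (simp add: mult.assoc)
  qed
  also have "\<dots> = (c * k) * (\<bar>a\<bar> * (c * norm b))" by (simp add: power2_eq_square)
  also have "\<dots> \<le> (c * k) * E"
    using assms(1) amgm by (intro mult_left_mono) (auto simp: k_def)
  finally have le: "c\<^sup>2 * a * (\<beta> \<bullet> b) \<le> k * (c * E)" by (simp add: mult_ac)
  have "k * (c * E) \<le> 1 * (c * E)"
    using assms E by (intro mult_right_mono) (auto simp: k_def)
  with le show "c\<^sup>2 * a * (\<beta> \<bullet> b) \<le> c * ((a\<^sup>2 + c\<^sup>2 * (b \<bullet> b)) / 2)"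
    by (simp add: E_def)
  assume "a \<noteq> 0"
  then have "k * (c * E) < 1 * (c * E)"
    using assms E(2) by (intro mult_strict_right_mono) (auto simp: k_def)
  with le show "c\<^sup>2 * a * (\<beta> \<bullet> b) < c * ((a\<^sup>2 + c\<^sup>2 * (b \<bullet> b)) / 2)"
    by (simp add: E_def)
qed

lemma Basis_plane_time:
  "((0::plane), 1::real) \<in> Basis" "(axis i 1 :: plane, 0::real) \<in> Basis"
  by (auto simp: Basis_prod_def Basis_vec_def)

text \<open>\<open>E\<close> is the energy density and \<open>F\<close> the flux, which come from multiplying the wave equation by
  \<open>\<partial>\<^sub>t u\<close>. The mixed derivatives in \<open>\<partial>\<^sub>t E\<close> and \<open>div F\<close> cancel because they commute.\<close>

lemma energy_conservation:
  fixes u :: field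
  assumes "wave_solution J D c u" "open D" "open J"
    and a: "a = dir_deriv (0, 1) u" and b: "\<And>i::2. b i = dir_deriv (axis i 1, 0) u"
    and E: "\<And>p. E p = (a p * a p + c\<^sup>2 * (\<Sum>i\<in>UNIV. b i p * b i p)) * (1 / 2)"
    and F: "\<And>i p. F i p = - (c\<^sup>2) * (a p * b i p)"
  shows "C_diff_on 1 (D \<times> J) E" "\<And>i. C_diff_on 1 (D \<times> J) (F i)"
    and "\<And>p. p \<in> D \<times> J \<Longrightarrow>
      dir_deriv (0, 1) E p + (\<Sum>i\<in>UNIV. dir_deriv (axis i 1, 0) (F i) p) = 0"
proof -
  let ?S = "D \<times> J"
  have op: "open ?S" using assms(2,3) by (rule open_Times)
  have u: "C_diff_on 2 ?S u" and eq: "\<And>p. p \<in> ?S \<Longrightarrow> dt2 u p - c\<^sup>2 * laplacian u p = 0"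
    using assms(1) by (auto simp: wave_solution_def)
  have a1: "C_diff_on 1 ?S a" and b1: "\<And>i. C_diff_on 1 ?S (b i)"
    using u Basis_plane_time unfolding a b numeral_2_eq_2 One_nat_def
    by (simp_all del: One_nat_def)
  show "C_diff_on 1 ?S E" and "\<And>i. C_diff_on 1 ?S (F i)"
    unfolding E[abs_def] F[abs_def]
    by (intro C_diff_on_mult C_diff_on_add C_diff_on_sum C_diff_on_const a1 b1 op finite)+
  fix p assume p: "p \<in> ?S"
  have da: "(a has_derivative (\<lambda>e. dir_deriv e a p)) (at p)"
    and db: "\<And>i. (b i has_derivative (\<lambda>e. dir_deriv e (b i) p)) (at p)"
    using a1 b1 p by (auto intro!: has_derivative_dir_deriv)
  have dE: "dir_deriv (0, 1) E p = a p * dir_deriv (0, 1) a p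
      + c\<^sup>2 * (\<Sum>i\<in>UNIV. b i p * dir_deriv (0, 1) (b i) p)"
    unfolding E[abs_def]
    by (rule trans[OF dir_deriv_eq], (rule derivative_eq_intros da db refl)+)
      (simp add: sum_2 algebra_simps)
  have dF: "dir_deriv e (F i) p = - (c\<^sup>2) * (a p * dir_deriv e (b i) p + dir_deriv e a p * b i p)"
    for i e
    unfolding F[abs_def]
    by (rule trans[OF dir_deriv_eq], (rule derivative_eq_intros da db refl)+)
      (simp add: algebra_simps)
  have comm: "dir_deriv (axis i 1, 0) a p = dir_deriv (0, 1) (b i) p" for i
    unfolding a b using Basis_plane_time by (intro dir_deriv_commute[OF op p u])
  have wave: "dir_deriv (0, 1) a p = c\<^sup>2 * (\<Sum>i\<in>UNIV. dir_deriv (axis i 1, 0) (b i) p)"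
    using eq[OF p] unfolding dt2_def laplacian_def a b by simp
  show "dir_deriv (0, 1) E p + (\<Sum>i\<in>UNIV. dir_deriv (axis i 1, 0) (F i) p) = 0"
    unfolding dE dF comm wave
    by (simp add: sum_2 algebra_simps)
qed

lemma has_derivative_square_max_0:
  "((\<lambda>r::real. (max 0 r)\<^sup>2) has_derivative (\<lambda>h. 2 * max 0 r * h)) (at r)"
proof -
  consider "r < 0" | "r = 0" | "r > 0" by linarith
  then show ?thesis
  proof cases
    case 1
    have "((\<lambda>r. 0::real) has_derivative (\<lambda>h. 0)) (at r)" by simp
    then have "((\<lambda>r::real. (max 0 r)\<^sup>2) has_derivative (\<lambda>h. 0)) (at r)"
      by (rule has_derivative_transform_within_open[of _ _ _ _ "{..<0}"]) (use 1 in auto)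
    then show ?thesis using 1 by simp
  next
    case 2
    have "\<bar>(max 0 h)\<^sup>2 / h\<bar> \<le> \<bar>h\<bar>" for h :: real
      by (cases "h > 0") (auto simp: power2_eq_square)
    then have "\<forall>\<^sub>F h in at 0. norm ((max 0 h)\<^sup>2 / h) \<le> \<bar>h::real\<bar>"
      by (intro always_eventually) simp
    moreover have "((\<lambda>h::real. \<bar>h\<bar>) \<longlongrightarrow> 0) (at 0)"
      using tendsto_rabs_zero[OF tendsto_ident_at] .
    ultimately have "((\<lambda>h::real. (max 0 h)\<^sup>2 / h) \<longlongrightarrow> 0) (at 0)"
      by (rule Lim_null_comparison)
    then have "((\<lambda>r::real. (max 0 r)\<^sup>2) has_real_derivative 0) (at 0)"
      by (simp add: has_field_derivative_iff)
    then show ?thesis unfolding 2 has_field_derivative_def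
      by (rule has_derivative_eq_rhs) auto
  next
    case 3
    have "((\<lambda>r::real. r\<^sup>2) has_derivative (\<lambda>h. 2 * r * h)) (at r)"
      by (auto intro!: derivative_eq_intros)
    then have "((\<lambda>r::real. (max 0 r)\<^sup>2) has_derivative (\<lambda>h. 2 * r * h)) (at r)"
      by (rule has_derivative_transform_within_open[of _ _ _ _ "{0<..}"]) (use 3 in auto)
    then show ?thesis using 3 by simp
  qed
qed

text \<open>The weight is supported where \<open>\<psi> \<ge> 0\<close>, inside the backward cone
  \<open>c (t - s) + norm (y - x0) \<le> R\<close>. Squaring the positive part makes it \<open>C\<^sup>1\<close>, and \<open>\<delta>\<close> smooths the
  norm at the axis of the cone while keeping the length of its gradient \<open>\<beta>\<close> below \<open>1\<close>.\<close>

lemma cone_weight: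
  fixes x0 :: plane and s c R \<delta> :: real
  assumes "\<delta> > 0"
    and \<psi>: "\<And>p::plane \<times> real. \<psi> p = R - c * (snd p - s) - sqrt (\<delta>\<^sup>2 + (fst p - x0) \<bullet> (fst p - x0))"
    and w: "\<And>p. w p = (max 0 (\<psi> p))\<^sup>2"
    and \<beta>: "\<And>p. \<beta> p = (1 / sqrt (\<delta>\<^sup>2 + (fst p - x0) \<bullet> (fst p - x0))) *\<^sub>R (fst p - x0)"
  shows "continuous_on UNIV \<psi>" and "C_diff_on 1 UNIV w"
    and "\<And>p. norm (\<beta> p) < 1"
    and "\<And>p h k. dir_deriv (h, k) w p = 2 * max 0 (\<psi> p) * (- (c * k) - \<beta> p \<bullet> h)"
proof -
  define N where "N p = sqrt (\<delta>\<^sup>2 + (fst p - x0) \<bullet> (fst p - x0))" for p :: "plane \<times> real"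
  have pos: "\<delta>\<^sup>2 + (fst p - x0) \<bullet> (fst p - x0) > 0" for p :: "plane \<times> real"
    using assms(1) by (simp add: add_pos_nonneg)
  have N: "N p > 0" for p using pos by (simp add: N_def)
  show cont\<psi>: "continuous_on UNIV \<psi>"
    unfolding \<psi>[abs_def] by (intro continuous_intros)
  have contN: "continuous_on UNIV N"
    unfolding N_def by (intro continuous_intros)
  have dN: "(N has_derivative (\<lambda>e. \<beta> p \<bullet> fst e)) (at p)" for p
  proof -
    have "((\<lambda>p. \<delta>\<^sup>2 + (fst p - x0) \<bullet> (fst p - x0)) has_derivative
        (\<lambda>e. 2 * ((fst p - x0) \<bullet> fst e))) (at p)"
      by (auto intro!: derivative_eq_intros simp: inner_commute)
    from has_derivative_compose[OF this DERIV_real_sqrt[OF pos, unfolded has_field_derivative_def]]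
    show ?thesis
      unfolding N_def by (rule has_derivative_eq_rhs) (simp add: \<beta> fun_eq_iff inverse_eq_divide)
  qed
  have d\<psi>: "(\<psi> has_derivative (\<lambda>e. - (c * snd e) - \<beta> p \<bullet> fst e)) (at p)" for p
    unfolding \<psi>[abs_def] N_def[symmetric]
    by (rule derivative_eq_intros dN refl)+ (auto simp: fun_eq_iff)
  have dw: "(w has_derivative (\<lambda>e. 2 * max 0 (\<psi> p) * (- (c * snd e) - \<beta> p \<bullet> fst e))) (at p)" for p
    unfolding w[abs_def] by (rule has_derivative_compose[OF d\<psi> has_derivative_square_max_0])
  show "norm (\<beta> p) < 1" for p
  proof -
    have "norm (fst p - x0) < N p"
      unfolding N_def norm_eq_sqrt_inner using assms(1) by simp
    then show ?thesis using N[of p] unfolding \<beta>[abs_def] N_def[symmetric] by simp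
  qed
  show dir: "dir_deriv (h, k) w p = 2 * max 0 (\<psi> p) * (- (c * k) - \<beta> p \<bullet> h)" for p h k
    using dir_deriv_eq[OF dw, of "(h, k)"] by simp
  have "continuous_on UNIV \<beta>"
    unfolding \<beta>[abs_def] N_def[symmetric] using N
    by (intro continuous_intros contN) (auto simp: less_imp_neq[symmetric])
  then have "continuous_on UNIV (\<lambda>p. 2 * max 0 (\<psi> p) * (- (c * k) - \<beta> p \<bullet> h))" for h k
    by (intro continuous_intros cont\<psi>)
  then have "continuous_on UNIV (dir_deriv e w)" for e
    using dir[of "fst e" "snd e"] by (simp add: fun_eq_iff[symmetric])
  then show "C_diff_on 1 UNIV w" using differentiableI[OF dw] by simp
qed

text \<open>The energy current \<open>(E, F)\<close> is divergence-free. Multiplied by a weight supported in a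
  backward cone, it becomes compactly supported, since the field vanishes before time \<open>s\<close>; the
  integral of its divergence is then zero. The integrand has a sign because the weight has
  spacelike level sets: where it is positive, it decreases in time faster than \<open>c\<close> times its
  variation in space. Hence the integrand vanishes, and \<open>\<partial>\<^sub>t u = 0\<close> inside the cone.\<close>

lemma time_derivative_vanishes_in_cone:
  fixes u :: field
  assumes "open D" and sol: "wave_solution {0<..} D c u" and "c > 0" and "s > 0"
    and quiet: "\<And>x t. x \<in> D \<Longrightarrow> 0 < t \<Longrightarrow> t \<le> s \<Longrightarrow> u (x, t) = 0"
    and ball: "ball x0 d \<subseteq> D" and cone: "norm (y - x0) + c * (t - s) < d" "s \<le> t"
  shows "dir_deriv (0, 1) u (y, t) = 0"
proof (rule ccontr)
  let ?U = "D \<times> {(0::real)<..}"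
  assume nz: "dir_deriv (0, 1) u (y, t) \<noteq> 0"
  have opU: "open ?U" using \<open>open D\<close> by (intro open_Times) auto
  \<comment> \<open>There is room for a cone of radius \<open>R < d\<close>, whose closed base still lies in \<open>D\<close>, and for
    a smoothing \<open>\<delta>\<close> so small that \<open>\<psi>\<close> remains positive at \<open>(y, t)\<close>.\<close>
  obtain R where R: "norm (y - x0) + c * (t - s) < R" "R < d" using cone(1) dense by blast
  define \<delta> where "\<delta> = (R - (norm (y - x0) + c * (t - s))) / 2"
  have \<delta>: "\<delta> > 0" using R by (simp add: \<delta>_def)
  define \<psi> where "\<psi> p = R - c * (snd p - s) - sqrt (\<delta>\<^sup>2 + (fst p - x0) \<bullet> (fst p - x0))"
    for p :: "plane \<times> real"
  define w where "w p = (max 0 (\<psi> p))\<^sup>2" for p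
  define \<beta> where "\<beta> p = (1 / sqrt (\<delta>\<^sup>2 + (fst p - x0) \<bullet> (fst p - x0))) *\<^sub>R (fst p - x0)"
    for p :: "plane \<times> real"
  note weight = cone_weight[OF \<delta> \<psi>_def w_def \<beta>_def]
  define a where "a = dir_deriv (0, 1) u"
  define b where "b i = dir_deriv (axis i 1, 0) u" for i :: 2
  define E where "E p = (a p * a p + c\<^sup>2 * (\<Sum>i\<in>UNIV. b i p * b i p)) * (1 / 2)" for p
  define F where "F i p = - (c\<^sup>2) * (a p * b i p)" for i p
  have "open {(0::real)<..}" by simp
  note energy = energy_conservation[OF sol \<open>open D\<close> this a_def b_def E_def F_def]
  \<comment> \<open>Below time \<open>s\<close> the current vanishes because the field does; elsewhere the weight cuts it off.\<close>
  define K where "K = {p. s \<le> snd p \<and> 0 \<le> \<psi> p}"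
  have root: "norm (fst p - x0) < sqrt (\<delta>\<^sup>2 + (fst p - x0) \<bullet> (fst p - x0))" for p :: "plane \<times> real"
    unfolding norm_eq_sqrt_inner using \<delta> by simp
  have Kbox: "norm (fst p - x0) < R" "snd p \<le> s + R / c" if "p \<in> K" for p
  proof -
    have "c * (snd p - s) + norm (fst p - x0) < R" "c * (snd p - s) \<ge> 0"
      using that root[of p] \<open>c > 0\<close> by (auto simp: K_def \<psi>_def)
    then show "norm (fst p - x0) < R" by linarith
    have "c * (snd p - s) \<le> R"
      using \<open>c * (snd p - s) + norm (fst p - x0) < R\<close> norm_ge_zero[of "fst p - x0"] by linarith
    then have "snd p - s \<le> R / c" using \<open>c > 0\<close> by (simp add: pos_le_divide_eq mult.commute)
    then show "snd p \<le> s + R / c" by linarith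
  qed
  have closedK: "closed K"
    unfolding K_def using weight(1)
    by (intro closed_Collect_conj closed_Collect_le continuous_intros)
  have "K \<subseteq> cball x0 R \<times> {s..s + R / c}"
    using Kbox by (force simp: K_def mem_Times_iff dist_norm norm_minus_commute)
  then have compactK: "compact K"
    using closedK compact_Int_closed[of "cball x0 R \<times> {s..s + R / c}" K]
    by (metis compact_Times compact_cball compact_Icc inf.absorb2)
  have KU: "K \<subseteq> ?U"
  proof
    fix p assume p: "p \<in> K"
    have "fst p \<in> ball x0 d" using Kbox(1)[OF p] R(2) by (simp add: dist_norm norm_minus_commute)
    then show "p \<in> ?U" using p \<open>s > 0\<close> ball by (auto simp: K_def mem_Times_iff)
  qed
  have early: "dir_deriv e u p = 0" if "p \<in> ?U" "snd p < s" for e p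
    using that quiet \<open>open D\<close>
    by (intro dir_deriv_zero_open[of "D \<times> {0<..<s}"]) (auto simp: open_Times)
  have vanish: "w p * E p = 0" "w p * F i p = 0" if "p \<in> ?U - K" for p i
  proof -
    have "snd p < s \<or> \<psi> p < 0" using that by (auto simp: K_def)
    then show "w p * E p = 0" "w p * F i p = 0"
      using that early[of p] by (auto simp: w_def E_def F_def a_def b_def)
  qed
  define GE where "GE p = (if p \<in> ?U then w p * E p else 0)" for p
  define GF where "GF i p = (if p \<in> ?U then w p * F i p else 0)" for i p
  have w1: "C_diff_on 1 ?U w" using weight(2) C_diff_on_subset by blast
  have GE: "C_diff_on 1 UNIV GE" and GF: "C_diff_on 1 UNIV (GF i)" for i
    unfolding GE_def[abs_def] GF_def[abs_def]
    using w1 energy(1,2) vanish closedK KU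
    by (auto intro!: C_diff_on_extend_zero[OF opU _ closedK KU] C_diff_on_mult[OF opU]
        simp del: C_diff_on.simps One_nat_def)
  have GE0: "GE p = 0" and GF0: "GF i p = 0" if "p \<notin> K" for p i
    using that vanish by (auto simp: GE_def GF_def)
  define I where "I p = dir_deriv (0, 1) GE p + (\<Sum>i\<in>UNIV. dir_deriv (axis i 1, 0) (GF i) p)" for p
  have contI: "continuous_on UNIV I"
    unfolding I_def using GE GF
    by (intro continuous_intros continuous_on_dir_deriv[of 0]) auto
  have intI: "integrable lborel I" "(\<integral>p. I p \<partial>lborel) = 0"
    unfolding I_def
    using integral_dir_deriv_compact_support[OF GE compactK GE0]
      integral_dir_deriv_compact_support[OF GF compactK GF0]
    by simp_all
  have I_inside: "I p = 2 * max 0 (\<psi> p) * (- (c * E p) - (\<Sum>i\<in>UNIV. \<beta> p $ i * F i p))"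
    if p: "p \<in> ?U" for p
  proof -
    have dw: "w differentiable (at p)" "E differentiable (at p)" "F i differentiable (at p)" for i
      using w1 energy(1,2) p by auto
    have "dir_deriv e GE p = w p * dir_deriv e E p + dir_deriv e w p * E p" for e
      using dir_deriv_cong_open[OF opU p, of GE "\<lambda>p. w p * E p"] dir_deriv_mult[OF dw(1,2)]
      by (simp add: GE_def)
    moreover have "dir_deriv e (GF i) p = w p * dir_deriv e (F i) p + dir_deriv e w p * F i p" for e i
      using dir_deriv_cong_open[OF opU p, of "GF i" "\<lambda>p. w p * F i p"] dir_deriv_mult[OF dw(1,3)]
      by (simp add: GF_def)
    ultimately have "I p = w p * (dir_deriv (0, 1) E p + (\<Sum>i\<in>UNIV. dir_deriv (axis i 1, 0) (F i) p))
        + (dir_deriv (0, 1) w p * E p + (\<Sum>i\<in>UNIV. dir_deriv (axis i 1, 0) w p * F i p))"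
      by (simp add: I_def sum.distrib sum_distrib_left algebra_simps)
    also have "\<dots> = dir_deriv (0, 1) w p * E p + (\<Sum>i\<in>UNIV. dir_deriv (axis i 1, 0) w p * F i p)"
      using energy(3)[OF p] by simp
    also have "\<dots> = 2 * max 0 (\<psi> p) * (- (c * E p) - (\<Sum>i\<in>UNIV. \<beta> p $ i * F i p))"
      unfolding weight(4) by (simp add: inner_axis sum_2 algebra_simps)
    finally show ?thesis .
  qed
  have flux: "- (c * E p) - (\<Sum>i\<in>UNIV. \<beta> p $ i * F i p) =
     c\<^sup>2 * a p * (\<beta> p \<bullet> (\<chi> i. b i p)) - c * (((a p)\<^sup>2 + c\<^sup>2 * ((\<chi> i. b i p) \<bullet> (\<chi> i. b i p))) / 2)" for p
    by (simp add: E_def F_def inner_vec_def sum_2 power2_eq_square algebra_simps)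
  have I_nonpos: "I p \<le> 0" for p
  proof (cases "p \<in> ?U")
    case True
    have "- (c * E p) - (\<Sum>i\<in>UNIV. \<beta> p $ i * F i p) \<le> 0"
      unfolding flux
      using energy_flux_bound(1)[OF \<open>c > 0\<close> weight(3)[of p], of "a p" "\<chi> i. b i p"] by linarith
    then show ?thesis unfolding I_inside[OF True]
      by (intro mult_nonneg_nonpos) auto
  next
    case False
    then have "p \<in> - K" using KU by auto
    then have "dir_deriv e GE p = 0" "dir_deriv e (GF i) p = 0" for e i
      using closedK GE0 GF0 by (auto intro!: dir_deriv_zero_open[of "- K" p])
    then have "I p = 0" by (simp add: I_def)
    then show ?thesis by simp
  qed
  have "- I (y, t) = 0"
    by (rule continuous_nonneg_integral_zero)
      (use contI intI I_nonpos in \<open>auto intro: continuous_on_minus\<close>)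
  then have I0: "I (y, t) = 0" by simp
  have "norm (y - x0) < d" using cone \<open>c > 0\<close> mult_nonneg_nonneg[of c "t - s"] by linarith
  then have yt: "(y, t) \<in> ?U"
    using ball cone(2) \<open>s > 0\<close> by (auto simp: dist_norm norm_minus_commute subset_iff)
  have "sqrt (\<delta>\<^sup>2 + (norm (y - x0))\<^sup>2) \<le> \<delta> + norm (y - x0)"
    using \<delta> by (intro sqrt_sum_squares_le_sum) auto
  then have "\<psi> (y, t) > 0"
    using \<delta> by (simp add: \<psi>_def power2_norm_eq_inner[symmetric]) (simp add: \<delta>_def field_simps)
  moreover have "- (c * E (y, t)) - (\<Sum>i\<in>UNIV. \<beta> (y, t) $ i * F i (y, t)) < 0"
    unfolding flux
    using energy_flux_bound(2)[OF \<open>c > 0\<close> weight(3)[of "(y, t)"], of "a (y, t)" "\<chi> i. b i (y, t)"] nz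
    by (simp add: a_def)
  ultimately have "I (y, t) < 0"
    unfolding I_inside[OF yt] by (intro mult_pos_neg) auto
  with I0 show False by simp
qed

lemma wave_vanishes_in_cone:
  fixes u :: field
  assumes "open D" and sol: "wave_solution {0<..} D c u" and "c > 0" and "s > 0"
    and quiet: "\<And>x t. x \<in> D \<Longrightarrow> 0 < t \<Longrightarrow> t \<le> s \<Longrightarrow> u (x, t) = 0"
    and ball: "ball x0 d \<subseteq> D" and cone: "norm (y - x0) + c * (t - s) < d" "s \<le> t"
  shows "u (y, t) = 0"
proof (cases "s < t")
  case False
  have "y \<in> ball x0 d" using cone False by (simp add: dist_norm norm_minus_commute)
  then show ?thesis using quiet[of y t] ball cone(2) False \<open>s > 0\<close> by auto
next
  case True
  have before: "norm (y - x0) + c * (\<tau> - s) < d" if "\<tau> \<le> t" for \<tau>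
    using cone(1) that \<open>c > 0\<close> mult_left_mono[of "\<tau> - s" "t - s" c] by linarith
  then have yD: "y \<in> D" using before[of s] cone(2) ball
    by (auto simp: dist_norm norm_minus_commute subset_iff)
  have "((\<lambda>t. u (y, t)) has_real_derivative 0) (at \<tau>)" if "s \<le> \<tau>" "\<tau> \<le> t" for \<tau>
  proof -
    have diff: "u differentiable (at (y, \<tau>))"
      using sol yD that \<open>s > 0\<close> by (auto simp: wave_solution_def numeral_2_eq_2)
    have zero: "dir_deriv (0, 1) u (y, \<tau>) = 0"
      using time_derivative_vanishes_in_cone[OF assms(1-4) quiet ball before] that by blast
    have "((\<lambda>t. u (y, t)) has_derivative (\<lambda>k. dir_deriv (0, k) u (y, \<tau>))) (at \<tau>)"
      by (rule has_derivative_compose[where g = u and f = "\<lambda>t. (y, t)"])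
        (auto intro!: derivative_eq_intros has_derivative_dir_deriv diff)
    moreover have "dir_deriv (0, k) u (y, \<tau>) = 0 * k" for k
      using linear_scale[OF has_derivative_linear[OF has_derivative_dir_deriv[OF diff]], of k "(0, 1)"]
        zero by simp
    ultimately show ?thesis unfolding has_field_derivative_def by (simp only:)
  qed
  then have "\<exists>z>s. z < t \<and> u (y, t) - u (y, s) = (t - s) * 0"
    by (intro MVT2 True)
  then show ?thesis using quiet[OF yD, of s] \<open>s > 0\<close> by auto
qed

section \<open>Jump conditions\<close>

text \<open>If \<open>\<nu>\<close> and \<open>\<nu>'\<close> were different, the ray from \<open>x\<close> in direction \<open>\<nu>' - \<nu>\<close> would lie in the cone around
  \<open>\<nu>'\<close> and in the one around \<open>- \<nu>\<close>, hence near \<open>x\<close> both in \<open>A\<close> and in \<open>B\<close>.\<close>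

lemma is_unit_normal_unique:
  assumes "is_unit_normal A B x \<nu>" "is_unit_normal A B x \<nu>'" "A \<inter> B = {}"
  shows "\<nu> = \<nu>'"
proof (rule ccontr)
  assume ne: "\<nu> \<noteq> \<nu>'"
  have n: "\<nu> \<bullet> \<nu> = 1" "\<nu>' \<bullet> \<nu>' = 1"
    using assms(1,2) by (auto simp: is_unit_normal_def norm_eq_1)
  define e where "e = \<nu>' - \<nu>"
  define k where "k = 1 - \<nu> \<bullet> \<nu>'"
  have "e \<bullet> e = 2 * k" by (simp add: e_def k_def n algebra_simps inner_commute)
  moreover have "e \<noteq> 0" using ne by (simp add: e_def)
  ultimately have k: "k > 0" using inner_gt_zero_iff[of e] by simp
  have ek: "\<nu> \<bullet> e = - k" "\<nu>' \<bullet> e = k" by (simp_all add: e_def k_def n algebra_simps inner_commute)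
  define \<epsilon> where "\<epsilon> = k / (2 * norm e)"
  have \<epsilon>: "\<epsilon> > 0" "\<epsilon> * norm e < k" using k \<open>e \<noteq> 0\<close> by (auto simp: \<epsilon>_def)
  obtain \<delta> where \<delta>: "\<delta> > 0"
    "\<And>y. norm (y - x) < \<delta> \<Longrightarrow> \<nu> \<bullet> (y - x) < - \<epsilon> * norm (y - x) \<Longrightarrow> y \<in> B"
    using assms(1) \<epsilon>(1) unfolding is_unit_normal_def by blast
  obtain \<delta>' where \<delta>': "\<delta>' > 0"
    "\<And>y. norm (y - x) < \<delta>' \<Longrightarrow> \<nu>' \<bullet> (y - x) > \<epsilon> * norm (y - x) \<Longrightarrow> y \<in> A"
    using assms(2) \<epsilon>(1) unfolding is_unit_normal_def by blast
  define h where "h = min \<delta> \<delta>' / (2 * norm e)"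
  have h: "h > 0" "h * norm e < \<delta>" "h * norm e < \<delta>'"
    using \<delta>(1) \<delta>'(1) \<open>e \<noteq> 0\<close> by (auto simp: h_def)
  have "h * (\<epsilon> * norm e) < h * k" using h(1) \<epsilon>(2) by simp
  then have "x + h *\<^sub>R e \<in> A" "x + h *\<^sub>R e \<in> B"
    using h \<delta>(2)[of "x + h *\<^sub>R e"] \<delta>'(2)[of "x + h *\<^sub>R e"] ek by (auto simp: algebra_simps)
  then show False using assms(3) by auto
qed

lemma unit_normal_eq:
  "is_unit_normal A B x \<nu> \<Longrightarrow> A \<inter> B = {} \<Longrightarrow> unit_normal A B x = \<nu>"
  unfolding unit_normal_def by (rule the_equality) (auto intro: is_unit_normal_unique)

lemma unit_normal_enters:
  assumes "is_unit_normal A B x \<nu>"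
  shows "\<forall>\<^sub>F h in at_right 0. x + h *\<^sub>R \<nu> \<in> A" "\<forall>\<^sub>F h in at_left 0. x + h *\<^sub>R \<nu> \<in> B"
proof -
  have n: "norm \<nu> = 1" "\<nu> \<bullet> \<nu> = 1" using assms by (auto simp: is_unit_normal_def norm_eq_1)
  have "(0::real) < 1 / 2" by simp
  then obtain \<delta> where \<delta>: "\<delta> > 0"
    "\<forall>y. norm (y - x) < \<delta> \<longrightarrow> (\<nu> \<bullet> (y - x) > 1 / 2 * norm (y - x) \<longrightarrow> y \<in> A) \<and>
        (\<nu> \<bullet> (y - x) < - (1 / 2) * norm (y - x) \<longrightarrow> y \<in> B)"
    using assms unfolding is_unit_normal_def by blast
  have "x + h *\<^sub>R \<nu> \<in> A" if "h \<in> {0<..<\<delta>}" for h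
    using that n \<delta>(2)[rule_format, of "x + h *\<^sub>R \<nu>"] by simp
  then show "\<forall>\<^sub>F h in at_right 0. x + h *\<^sub>R \<nu> \<in> A"
    using \<delta>(1) by (intro eventually_at_rightI[of 0 \<delta>]) auto
  have "x + h *\<^sub>R \<nu> \<in> B" if "h \<in> {-\<delta><..<0}" for h
    using that n \<delta>(2)[rule_format, of "x + h *\<^sub>R \<nu>"] by simp
  then show "\<forall>\<^sub>F h in at_left 0. x + h *\<^sub>R \<nu> \<in> B"
    using \<delta>(1) by (intro eventually_at_leftI[of "- \<delta>" 0]) auto
qed

lemma length_null_Un:
  assumes "length_null S" "length_null S'"
  shows "length_null (S \<union> S')"
  unfolding length_null_def
proof (intro allI impI)
  fix \<epsilon> :: real assume "\<epsilon> > 0"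
  then have \<epsilon>: "\<epsilon> / 2 > 0" by simp
  obtain z r where 1: "\<forall>i::nat. 0 \<le> r i" "summable r" "(\<Sum>i. r i) < \<epsilon> / 2"
    "S \<subseteq> (\<Union>i. cball (z i) (r i))"
    using assms(1)[unfolded length_null_def, rule_format, OF \<epsilon>]
    by (elim exE conjE) (rule that; assumption)
  obtain z' r' where 2: "\<forall>i::nat. 0 \<le> r' i" "summable r'" "(\<Sum>i. r' i) < \<epsilon> / 2"
    "S' \<subseteq> (\<Union>i. cball (z' i) (r' i))"
    using assms(2)[unfolded length_null_def, rule_format, OF \<epsilon>]
    by (elim exE conjE) (rule that; assumption)
  define R where "R n = (if even n then r' (n div 2) else r ((n - 1) div 2))" for n
  define Z where "Z n = (if even n then z' (n div 2) else z ((n - 1) div 2))" for n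
  have "R sums (suminf r + suminf r')"
    unfolding R_def by (intro sums_if summable_sums 1(2) 2(2))
  then have R: "summable R" "suminf R < \<epsilon>"
    using 1(3) 2(3) unfolding sums_iff by linarith+
  have upper: "cball (Z i) (R i) \<subseteq> (\<Union>i. cball (Z i) (R i))" for i
    by (rule UN_upper) simp
  have "cball (z i) (r i) = cball (Z (2 * i + 1)) (R (2 * i + 1))" for i
    by (simp add: Z_def R_def)
  then have "S \<subseteq> (\<Union>i. cball (Z i) (R i))"
    by (intro order_trans[OF 1(4)] UN_least) (simp add: upper)
  moreover have "cball (z' i) (r' i) = cball (Z (2 * i)) (R (2 * i))" for i
    by (simp add: Z_def R_def)
  then have "S' \<subseteq> (\<Union>i. cball (Z i) (R i))"
    by (intro order_trans[OF 2(4)] UN_least) (simp add: upper)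
  moreover have "\<forall>i. 0 \<le> R i" using 1(1) 2(1) by (simp add: R_def)
  ultimately show "\<exists>z r. (\<forall>i::nat. 0 \<le> r i) \<and> summable r \<and> (\<Sum>i. r i) < \<epsilon> \<and> S \<union> S' \<subseteq> (\<Union>i. cball (z i) (r i))"
    using R by (intro exI[of _ Z] exI[of _ R] conjI Un_least)
qed

lemma transmission_cong:
  assumes "transmission J G A B Dv Dw \<rho>v \<rho>w f g v w" "J' \<subseteq> J"
    and "\<And>x t. x \<in> G \<Longrightarrow> t \<in> J' \<Longrightarrow> f' (x, t) = f (x, t) \<and> g' (x, t) = g (x, t)"
  shows "transmission J' G A B Dv Dw \<rho>v \<rho>w f' g' v w"
proof -
  have "\<exists>a b. ((\<lambda>y. v (y, t)) \<longlongrightarrow> a) (at x within Dv) \<and>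
        ((\<lambda>y. w (y, t)) \<longlongrightarrow> b) (at x within Dw) \<and> b - a = f' (x, t)"
    if "t \<in> J'" "x \<in> G" for t x
  proof -
    have "\<exists>a b. ((\<lambda>y. v (y, t)) \<longlongrightarrow> a) (at x within Dv) \<and>
        ((\<lambda>y. w (y, t)) \<longlongrightarrow> b) (at x within Dw) \<and> b - a = f (x, t)"
      using assms(1,2) that unfolding transmission_def by blast
    then show ?thesis using assms(3) that by simp
  qed
  moreover have "\<exists>N. length_null N \<and> (\<forall>x\<in>G - N. \<exists>\<nu> a b.
        is_unit_normal A B x \<nu> \<and>
        ((\<lambda>h. dir_deriv (\<nu>, 0) v (x + h *\<^sub>R \<nu>, t)) \<longlongrightarrow> a) (at_right 0) \<and>
        ((\<lambda>h. dir_deriv (\<nu>, 0) w (x + h *\<^sub>R \<nu>, t)) \<longlongrightarrow> b) (at_left 0) \<and>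
        b / \<rho>w - a / \<rho>v = g' (x, t))" if t: "t \<in> J'" for t
  proof -
    obtain N where N: "length_null N" "\<forall>x\<in>G - N. \<exists>\<nu> a b.
        is_unit_normal A B x \<nu> \<and>
        ((\<lambda>h. dir_deriv (\<nu>, 0) v (x + h *\<^sub>R \<nu>, t)) \<longlongrightarrow> a) (at_right 0) \<and>
        ((\<lambda>h. dir_deriv (\<nu>, 0) w (x + h *\<^sub>R \<nu>, t)) \<longlongrightarrow> b) (at_left 0) \<and>
        b / \<rho>w - a / \<rho>v = g (x, t)"
      using assms(1,2) t unfolding transmission_def by blast
    then show ?thesis using assms(3)[OF _ t] by (intro exI[of _ N]) auto
  qed
  ultimately show ?thesis unfolding transmission_def by blast
qed

text \<open>The jump conditions demand a normal almost everywhere even for vanishing fields. Its existence is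
  inherited from the given pair \<open>v\<close>, \<open>w\<close>.\<close>

lemma transmission_zero:
  assumes "transmission J G A B Dv Dw \<rho>v \<rho>w f g v w"
    and "\<And>x t. x \<in> G \<Longrightarrow> t \<in> J \<Longrightarrow> f (x, t) = 0 \<and> g (x, t) = 0"
  shows "transmission J G A B Dv Dw \<rho>v \<rho>w f g (\<lambda>p. 0) (\<lambda>p. 0)"
proof -
  have zero: "dir_deriv e (\<lambda>p. 0::real) = (\<lambda>p. 0)" for e :: "plane \<times> real"
    using dir_deriv_eq[OF has_derivative_const] by blast
  have normals: "\<exists>N. length_null N \<and> (\<forall>x\<in>G - N. \<exists>\<nu>. is_unit_normal A B x \<nu>)" if t: "t \<in> J" for t
  proof -
    obtain N where "length_null N" "\<forall>x\<in>G - N. \<exists>\<nu> a b.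
        is_unit_normal A B x \<nu> \<and>
        ((\<lambda>h. dir_deriv (\<nu>, 0) v (x + h *\<^sub>R \<nu>, t)) \<longlongrightarrow> a) (at_right 0) \<and>
        ((\<lambda>h. dir_deriv (\<nu>, 0) w (x + h *\<^sub>R \<nu>, t)) \<longlongrightarrow> b) (at_left 0) \<and>
        b / \<rho>w - a / \<rho>v = g (x, t)"
      using assms(1) t unfolding transmission_def by blast
    then show ?thesis by blast
  qed
  show ?thesis unfolding transmission_def
  proof (intro conjI ballI)
    fix t assume t: "t \<in> J"
    show "\<exists>a b. ((\<lambda>y. 0) \<longlongrightarrow> a) (at x within Dv) \<and> ((\<lambda>y. 0) \<longlongrightarrow> b) (at x within Dw) \<and> b - a = f (x, t)"
      if "x \<in> G" for x
      using assms(2)[OF that t] by (intro exI[of _ 0]) simp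
    obtain N where N: "length_null N" "\<forall>x\<in>G - N. \<exists>\<nu>. is_unit_normal A B x \<nu>"
      using normals[OF t] by blast
    show "\<exists>N. length_null N \<and> (\<forall>x\<in>G - N. \<exists>\<nu> a b. is_unit_normal A B x \<nu> \<and>
        ((\<lambda>h. dir_deriv (\<nu>, 0) (\<lambda>p. 0) (x + h *\<^sub>R \<nu>, t)) \<longlongrightarrow> a) (at_right 0) \<and>
        ((\<lambda>h. dir_deriv (\<nu>, 0) (\<lambda>p. 0) (x + h *\<^sub>R \<nu>, t)) \<longlongrightarrow> b) (at_left 0) \<and>
        b / \<rho>w - a / \<rho>v = g (x, t))"
    proof (intro exI[of _ N] conjI ballI)
      fix x assume x: "x \<in> G - N"
      then obtain \<nu> where "is_unit_normal A B x \<nu>" using N(2) by blast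
      then show "\<exists>\<nu> a b. is_unit_normal A B x \<nu> \<and>
        ((\<lambda>h. dir_deriv (\<nu>, 0) (\<lambda>p. 0) (x + h *\<^sub>R \<nu>, t)) \<longlongrightarrow> a) (at_right 0) \<and>
        ((\<lambda>h. dir_deriv (\<nu>, 0) (\<lambda>p. 0) (x + h *\<^sub>R \<nu>, t)) \<longlongrightarrow> b) (at_left 0) \<and>
        b / \<rho>w - a / \<rho>v = g (x, t)"
        using x assms(2)[OF _ t, of x] unfolding zero
        by (intro exI[of _ \<nu>] exI[of _ 0]) simp
    qed (rule N(1))
  qed
qed

lemma tendsto_dir_deriv_add:
  assumes "\<forall>\<^sub>F h in F. u differentiable (at (q h)) \<and> v differentiable (at (q h))"
    and "((\<lambda>h. dir_deriv e u (q h)) \<longlongrightarrow> a) F" "((\<lambda>h. dir_deriv e v (q h)) \<longlongrightarrow> b) F"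
  shows "((\<lambda>h. dir_deriv e (\<lambda>p. u p + v p) (q h)) \<longlongrightarrow> a + b) F"
proof (rule Lim_transform_eventually[OF tendsto_add[OF assms(2,3)]])
  show "\<forall>\<^sub>F h in F. dir_deriv e u (q h) + dir_deriv e v (q h) = dir_deriv e (\<lambda>p. u p + v p) (q h)"
    using assms(1) by eventually_elim (simp add: dir_deriv_add)
qed

lemma transmission_add:
  assumes "transmission J G A B A B \<rho>v \<rho>w f g v w" "transmission J G A B A B \<rho>v \<rho>w f' g' v' w'"
    and "A \<inter> B = {}"
    and "\<And>p. p \<in> A \<times> J \<Longrightarrow> v differentiable (at p) \<and> v' differentiable (at p)"
    and "\<And>p. p \<in> B \<times> J \<Longrightarrow> w differentiable (at p) \<and> w' differentiable (at p)"
  shows "transmission J G A B A B \<rho>v \<rho>w (\<lambda>p. f p + f' p) (\<lambda>p. g p + g' p)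
    (\<lambda>p. v p + v' p) (\<lambda>p. w p + w' p)"
  unfolding transmission_def
proof (intro conjI ballI)
  fix t x assume tx: "t \<in> J" "x \<in> G"
  obtain a b where 1: "((\<lambda>y. v (y, t)) \<longlongrightarrow> a) (at x within A)"
      "((\<lambda>y. w (y, t)) \<longlongrightarrow> b) (at x within B)" "b - a = f (x, t)"
    using assms(1) tx unfolding transmission_def by blast
  obtain a' b' where 2: "((\<lambda>y. v' (y, t)) \<longlongrightarrow> a') (at x within A)"
      "((\<lambda>y. w' (y, t)) \<longlongrightarrow> b') (at x within B)" "b' - a' = f' (x, t)"
    using assms(2) tx unfolding transmission_def by blast
  show "\<exists>a b. ((\<lambda>y. v (y, t) + v' (y, t)) \<longlongrightarrow> a) (at x within A) \<and>
        ((\<lambda>y. w (y, t) + w' (y, t)) \<longlongrightarrow> b) (at x within B) \<and> b - a = f (x, t) + f' (x, t)"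
    using 1 2 by (intro exI[of _ "a + a'"] exI[of _ "b + b'"]) (auto intro!: tendsto_add)
next
  fix t assume t: "t \<in> J"
  obtain N where N: "length_null N" "\<And>x. x \<in> G - N \<Longrightarrow> \<exists>\<nu> a b.
        is_unit_normal A B x \<nu> \<and>
        ((\<lambda>h. dir_deriv (\<nu>, 0) v (x + h *\<^sub>R \<nu>, t)) \<longlongrightarrow> a) (at_right 0) \<and>
        ((\<lambda>h. dir_deriv (\<nu>, 0) w (x + h *\<^sub>R \<nu>, t)) \<longlongrightarrow> b) (at_left 0) \<and>
        b / \<rho>w - a / \<rho>v = g (x, t)"
    using assms(1) t unfolding transmission_def by blast
  obtain N' where N': "length_null N'" "\<And>x. x \<in> G - N' \<Longrightarrow> \<exists>\<nu> a b.
        is_unit_normal A B x \<nu> \<and>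
        ((\<lambda>h. dir_deriv (\<nu>, 0) v' (x + h *\<^sub>R \<nu>, t)) \<longlongrightarrow> a) (at_right 0) \<and>
        ((\<lambda>h. dir_deriv (\<nu>, 0) w' (x + h *\<^sub>R \<nu>, t)) \<longlongrightarrow> b) (at_left 0) \<and>
        b / \<rho>w - a / \<rho>v = g' (x, t)"
    using assms(2) t unfolding transmission_def by blast
  have "\<exists>\<nu> a b. is_unit_normal A B x \<nu> \<and>
        ((\<lambda>h. dir_deriv (\<nu>, 0) (\<lambda>p. v p + v' p) (x + h *\<^sub>R \<nu>, t)) \<longlongrightarrow> a) (at_right 0) \<and>
        ((\<lambda>h. dir_deriv (\<nu>, 0) (\<lambda>p. w p + w' p) (x + h *\<^sub>R \<nu>, t)) \<longlongrightarrow> b) (at_left 0) \<and>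
        b / \<rho>w - a / \<rho>v = g (x, t) + g' (x, t)" if x: "x \<in> G - (N \<union> N')" for x
  proof -
    obtain \<nu> a b where 1: "is_unit_normal A B x \<nu>"
        "((\<lambda>h. dir_deriv (\<nu>, 0) v (x + h *\<^sub>R \<nu>, t)) \<longlongrightarrow> a) (at_right 0)"
        "((\<lambda>h. dir_deriv (\<nu>, 0) w (x + h *\<^sub>R \<nu>, t)) \<longlongrightarrow> b) (at_left 0)"
        "b / \<rho>w - a / \<rho>v = g (x, t)"
      using N(2)[of x] x by blast
    obtain \<nu>' a' b' where 2: "is_unit_normal A B x \<nu>'"
        "((\<lambda>h. dir_deriv (\<nu>', 0) v' (x + h *\<^sub>R \<nu>', t)) \<longlongrightarrow> a') (at_right 0)"
        "((\<lambda>h. dir_deriv (\<nu>', 0) w' (x + h *\<^sub>R \<nu>', t)) \<longlongrightarrow> b') (at_left 0)"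
        "b' / \<rho>w - a' / \<rho>v = g' (x, t)"
      using N'(2)[of x] x by blast
    have \<nu>': "\<nu>' = \<nu>" using 1(1) 2(1) assms(3) is_unit_normal_unique by blast
    have "\<forall>\<^sub>F h in at_right 0. v differentiable (at (x + h *\<^sub>R \<nu>, t)) \<and> v' differentiable (at (x + h *\<^sub>R \<nu>, t))"
      "\<forall>\<^sub>F h in at_left 0. w differentiable (at (x + h *\<^sub>R \<nu>, t)) \<and> w' differentiable (at (x + h *\<^sub>R \<nu>, t))"
      using unit_normal_enters[OF 1(1)] t by (auto elim!: eventually_mono intro!: assms(4,5))
    note sums = this[THEN tendsto_dir_deriv_add]
    show ?thesis
      using 1 2 sums unfolding \<nu>'
      by (intro exI[of _ \<nu>] exI[of _ "a + a'"] exI[of _ "b + b'"])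
        (auto simp: add_divide_distrib)
  qed
  then show "\<exists>N. length_null N \<and> (\<forall>x\<in>G - N. \<exists>\<nu> a b. is_unit_normal A B x \<nu> \<and>
        ((\<lambda>h. dir_deriv (\<nu>, 0) (\<lambda>p. v p + v' p) (x + h *\<^sub>R \<nu>, t)) \<longlongrightarrow> a) (at_right 0) \<and>
        ((\<lambda>h. dir_deriv (\<nu>, 0) (\<lambda>p. w p + w' p) (x + h *\<^sub>R \<nu>, t)) \<longlongrightarrow> b) (at_left 0) \<and>
        b / \<rho>w - a / \<rho>v = g (x, t) + g' (x, t))"
    using length_null_Un[OF N(1) N'(1)] by blast
qed

text \<open>A field that is smooth across the interface has equal one-sided limits there. Adding it on one
  side only therefore changes the jumps by its own boundary values and normal derivative.\<close>

lemma transmission_add_regular: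
  assumes tr: "transmission J G A B A B \<rho>v \<rho>w f g v w" and "A \<inter> B = {}"
    and U: "open U" "G \<subseteq> U" "open J"
    and v: "\<And>p. p \<in> A \<times> J \<Longrightarrow> v differentiable (at p)"
    and w: "\<And>p. p \<in> B \<times> J \<Longrightarrow> w differentiable (at p)"
    and \<phi>: "C_diff_on 1 (U \<times> J) \<phi>" and \<omega>: "C_diff_on 1 (U \<times> J) \<omega>"
    and D: "Dv \<subseteq> A" "Dw \<subseteq> B"
  defines "n \<equiv> unit_normal A B"
  shows "transmission J G A B Dv Dw \<rho>v \<rho>w
    (\<lambda>p. f p + \<omega> p - \<phi> p)
    (\<lambda>p. g p + normal_deriv n \<omega> p / \<rho>w - normal_deriv n \<phi> p / \<rho>v)
    (\<lambda>p. v p + \<phi> p) (\<lambda>p. w p + \<omega> p)"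
  unfolding transmission_def
proof (intro conjI ballI)
  have op: "open (U \<times> J)" using U by (intro open_Times)
  have cont: "((\<lambda>y. \<eta> (y, t)) \<longlongrightarrow> \<eta> (x, t)) (at x within D)"
    if "C_diff_on 1 (U \<times> J) \<eta>" "t \<in> J" "x \<in> G" for \<eta> t x D
  proof -
    have "isCont \<eta> (x, t)"
      using C_diff_on_continuous[OF that(1)] op U(2) that(2,3)
      by (auto simp: continuous_on_eq_continuous_at)
    then show ?thesis
      by (rule isCont_tendsto_compose) (intro tendsto_intros)
  qed
  have limd: "((\<lambda>h. dir_deriv e \<eta> (x + h *\<^sub>R \<nu>, t)) \<longlongrightarrow> dir_deriv e \<eta> (x, t)) (at 0 within S)"
    and evd: "\<forall>\<^sub>F h in at 0 within S. \<eta> differentiable (at (x + h *\<^sub>R \<nu>, t))"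
    if "C_diff_on 1 (U \<times> J) \<eta>" "t \<in> J" "x \<in> G" for \<eta> e \<nu> t x S
  proof -
    have lim: "((\<lambda>h. (x + h *\<^sub>R \<nu>, t)) \<longlongrightarrow> (x, t)) (at 0 within S)"
      by (rule tendsto_eq_intros refl)+ simp
    have "continuous_on (U \<times> J) (dir_deriv e \<eta>)"
      using that(1) by (intro continuous_on_dir_deriv[of 0]) simp
    then have "isCont (dir_deriv e \<eta>) (x, t)"
      using op U(2) that(2,3) by (auto simp: continuous_on_eq_continuous_at)
    then show "((\<lambda>h. dir_deriv e \<eta> (x + h *\<^sub>R \<nu>, t)) \<longlongrightarrow> dir_deriv e \<eta> (x, t)) (at 0 within S)"
      by (rule isCont_tendsto_compose) (rule lim)
    have "\<forall>\<^sub>F h in at 0 within S. (x + h *\<^sub>R \<nu>, t) \<in> U \<times> J"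
      using U(2) that(2,3) by (intro topological_tendstoD[OF lim op]) auto
    then show "\<forall>\<^sub>F h in at 0 within S. \<eta> differentiable (at (x + h *\<^sub>R \<nu>, t))"
      using that(1) by (auto elim!: eventually_mono)
  qed
  {
    fix t x assume tx: "t \<in> J" "x \<in> G"
    obtain a b where 1: "((\<lambda>y. v (y, t)) \<longlongrightarrow> a) (at x within A)"
        "((\<lambda>y. w (y, t)) \<longlongrightarrow> b) (at x within B)" "b - a = f (x, t)"
      using tr tx unfolding transmission_def by blast
    show "\<exists>a b. ((\<lambda>y. v (y, t) + \<phi> (y, t)) \<longlongrightarrow> a) (at x within Dv) \<and>
          ((\<lambda>y. w (y, t) + \<omega> (y, t)) \<longlongrightarrow> b) (at x within Dw) \<and>
          b - a = f (x, t) + \<omega> (x, t) - \<phi> (x, t)"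
      using 1 tendsto_within_subset[OF 1(1) D(1)] tendsto_within_subset[OF 1(2) D(2)]
        cont[OF \<phi> tx] cont[OF \<omega> tx]
      by (intro exI[of _ "a + \<phi> (x, t)"] exI[of _ "b + \<omega> (x, t)"]) (auto intro!: tendsto_add)
  }
  fix t assume t: "t \<in> J"
  obtain N where N: "length_null N" "\<And>x. x \<in> G - N \<Longrightarrow> \<exists>\<nu> a b.
        is_unit_normal A B x \<nu> \<and>
        ((\<lambda>h. dir_deriv (\<nu>, 0) v (x + h *\<^sub>R \<nu>, t)) \<longlongrightarrow> a) (at_right 0) \<and>
        ((\<lambda>h. dir_deriv (\<nu>, 0) w (x + h *\<^sub>R \<nu>, t)) \<longlongrightarrow> b) (at_left 0) \<and>
        b / \<rho>w - a / \<rho>v = g (x, t)"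
    using tr t unfolding transmission_def by blast
  have "\<exists>\<nu> a b. is_unit_normal A B x \<nu> \<and>
        ((\<lambda>h. dir_deriv (\<nu>, 0) (\<lambda>p. v p + \<phi> p) (x + h *\<^sub>R \<nu>, t)) \<longlongrightarrow> a) (at_right 0) \<and>
        ((\<lambda>h. dir_deriv (\<nu>, 0) (\<lambda>p. w p + \<omega> p) (x + h *\<^sub>R \<nu>, t)) \<longlongrightarrow> b) (at_left 0) \<and>
        b / \<rho>w - a / \<rho>v = g (x, t) + normal_deriv n \<omega> (x, t) / \<rho>w - normal_deriv n \<phi> (x, t) / \<rho>v"
    if x: "x \<in> G - N" for x
  proof -
    obtain \<nu> a b where 1: "is_unit_normal A B x \<nu>"
        "((\<lambda>h. dir_deriv (\<nu>, 0) v (x + h *\<^sub>R \<nu>, t)) \<longlongrightarrow> a) (at_right 0)"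
        "((\<lambda>h. dir_deriv (\<nu>, 0) w (x + h *\<^sub>R \<nu>, t)) \<longlongrightarrow> b) (at_left 0)"
        "b / \<rho>w - a / \<rho>v = g (x, t)"
      using N(2)[OF x] by blast
    have n: "n x = \<nu>" unfolding n_def using 1(1) \<open>A \<inter> B = {}\<close> by (rule unit_normal_eq)
    have xG: "x \<in> G" using x by simp
    have "\<forall>\<^sub>F h in at_right 0. v differentiable (at (x + h *\<^sub>R \<nu>, t))"
      "\<forall>\<^sub>F h in at_left 0. w differentiable (at (x + h *\<^sub>R \<nu>, t))"
      using unit_normal_enters[OF 1(1)] t by (auto elim!: eventually_mono intro!: v w)
    then have "((\<lambda>h. dir_deriv (\<nu>, 0) (\<lambda>p. v p + \<phi> p) (x + h *\<^sub>R \<nu>, t)) \<longlongrightarrow>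
          a + dir_deriv (\<nu>, 0) \<phi> (x, t)) (at_right 0)"
      "((\<lambda>h. dir_deriv (\<nu>, 0) (\<lambda>p. w p + \<omega> p) (x + h *\<^sub>R \<nu>, t)) \<longlongrightarrow>
          b + dir_deriv (\<nu>, 0) \<omega> (x, t)) (at_left 0)"
      using evd[OF \<phi> t xG] evd[OF \<omega> t xG] limd[OF \<phi> t xG] limd[OF \<omega> t xG] 1(2,3)
      by (auto intro!: tendsto_dir_deriv_add eventually_conj)
    then show ?thesis using 1(1,4) n
      by (intro exI[of _ \<nu>] exI[of _ "a + dir_deriv (\<nu>, 0) \<phi> (x, t)"]
          exI[of _ "b + dir_deriv (\<nu>, 0) \<omega> (x, t)"])
        (auto simp: add_divide_distrib normal_deriv_def)
  qed
  then show "\<exists>N. length_null N \<and> (\<forall>x\<in>G - N. \<exists>\<nu> a b. is_unit_normal A B x \<nu> \<and>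
        ((\<lambda>h. dir_deriv (\<nu>, 0) (\<lambda>p. v p + \<phi> p) (x + h *\<^sub>R \<nu>, t)) \<longlongrightarrow> a) (at_right 0) \<and>
        ((\<lambda>h. dir_deriv (\<nu>, 0) (\<lambda>p. w p + \<omega> p) (x + h *\<^sub>R \<nu>, t)) \<longlongrightarrow> b) (at_left 0) \<and>
        b / \<rho>w - a / \<rho>v = g (x, t) + normal_deriv n \<omega> (x, t) / \<rho>w - normal_deriv n \<phi> (x, t) / \<rho>v)"
    using N(1) by blast
qed

section \<open>Superposition\<close>

lemma wave_solution_zero: "wave_solution J D c (\<lambda>p. 0)"
proof -
  have "dir_deriv e (\<lambda>p. 0::real) = (\<lambda>p. 0)" for e :: "plane \<times> real"
    using dir_deriv_eq[OF has_derivative_const] by blast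
  then show ?thesis
    unfolding wave_solution_def dt2_def laplacian_def by (simp add: C_diff_on_const del: C_diff_on.simps)
qed

lemma dir_deriv_add_twice:
  assumes "open S" "p \<in> S" "C_diff_on 2 S u" "C_diff_on 2 S v" "e \<in> Basis"
  shows "dir_deriv e (dir_deriv e (\<lambda>p. u p + v p)) p
    = dir_deriv e (dir_deriv e u) p + dir_deriv e (dir_deriv e v) p"
proof -
  have d: "u differentiable (at q)" "v differentiable (at q)"
    "dir_deriv e u differentiable (at q)" "dir_deriv e v differentiable (at q)" if "q \<in> S" for q
    using assms that by (auto simp: numeral_2_eq_2)
  have "dir_deriv e (dir_deriv e (\<lambda>p. u p + v p)) p = dir_deriv e (\<lambda>p. dir_deriv e u p + dir_deriv e v p) p"
    using assms(1,2) by (rule dir_deriv_cong_open) (simp add: dir_deriv_add d)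
  then show ?thesis using dir_deriv_add[OF d(3,4)] assms(2) by simp
qed

lemma wave_solution_add:
  assumes "open D" "open J" "wave_solution J D c u" "wave_solution J D c v"
  shows "wave_solution J D c (\<lambda>p. u p + v p)"
proof -
  have op: "open (D \<times> J)" using assms(1,2) by (rule open_Times)
  have C: "C_diff_on 2 (D \<times> J) u" "C_diff_on 2 (D \<times> J) v"
    using assms(3,4) by (auto simp: wave_solution_def)
  have "dt2 (\<lambda>p. u p + v p) p - c\<^sup>2 * laplacian (\<lambda>p. u p + v p) p = 0" if p: "p \<in> D \<times> J" for p
  proof -
    have "dt2 (\<lambda>p. u p + v p) p = dt2 u p + dt2 v p"
      unfolding dt2_def using Basis_plane_time by (intro dir_deriv_add_twice[OF op p C])
    moreover have "laplacian (\<lambda>p. u p + v p) p = laplacian u p + laplacian v p"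
      unfolding laplacian_def sum.distrib[symmetric]
      using Basis_plane_time by (intro sum.cong refl dir_deriv_add_twice[OF op p C])
    moreover have "dt2 u p - c\<^sup>2 * laplacian u p = 0" "dt2 v p - c\<^sup>2 * laplacian v p = 0"
      using assms(3,4) p by (auto simp: wave_solution_def)
    ultimately show ?thesis by (simp add: algebra_simps)
  qed
  then show ?thesis using C_diff_on_add[OF op C] unfolding wave_solution_def by blast
qed

lemma wave_solution_sum:
  assumes "open D" "open J" "\<And>m. m \<in> I \<Longrightarrow> wave_solution J D c (u m)"
  shows "wave_solution J D c (\<lambda>p. \<Sum>m\<in>I. u m p)"
  using assms(3)
  by (induction I rule: infinite_finite_induct)
    (auto simp: wave_solution_zero intro: wave_solution_add assms(1,2))

lemma wave_solution_subset:
  "wave_solution J D c u \<Longrightarrow> J' \<subseteq> J \<Longrightarrow> D' \<subseteq> D \<Longrightarrow> wave_solution J' D' c u"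
  unfolding wave_solution_def by (blast intro: C_diff_on_subset Sigma_mono)

lemma zero_initial_zero: "zero_initial J D (\<lambda>p. 0)"
  unfolding zero_initial_def by simp

lemma zero_initial_add:
  assumes "zero_initial J D u" "zero_initial J D v"
  shows "zero_initial J D (\<lambda>p. u p + v p)"
proof -
  have "((\<lambda>t. u (x, t) + v (x, t)) has_real_derivative 0 + 0) (at 0 within {0..})" if "x \<in> D" for x
    using assms that unfolding zero_initial_def by (intro DERIV_add) auto
  then show ?thesis
    using assms unfolding zero_initial_def by (auto intro: continuous_on_add)
qed

lemma zero_initial_sum:
  assumes "\<And>m. m \<in> I \<Longrightarrow> zero_initial J D (u m)"
  shows "zero_initial J D (\<lambda>p. \<Sum>m\<in>I. u m p)"
  using assms
  by (induction I rule: infinite_finite_induct) (auto simp: zero_initial_zero intro: zero_initial_add)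

lemma zero_initial_subset:
  assumes "zero_initial J D u" "J' \<subseteq> J" "D' \<subseteq> D"
  shows "zero_initial J' D' u"
proof -
  have "D' \<times> insert 0 J' \<subseteq> D \<times> insert 0 J" using assms(2,3) by auto
  then show ?thesis
    using assms(1,3) continuous_on_subset unfolding zero_initial_def by (metis subsetD)
qed

lemma transmission_sum:
  assumes "finite I" "I \<noteq> {}" "A \<inter> B = {}"
    and "\<And>m. m \<in> I \<Longrightarrow> transmission J G A B A B \<rho>v \<rho>w (f m) (g m) (v m) (w m)"
    and "\<And>m p. m \<in> I \<Longrightarrow> p \<in> A \<times> J \<Longrightarrow> v m differentiable (at p)"
    and "\<And>m p. m \<in> I \<Longrightarrow> p \<in> B \<times> J \<Longrightarrow> w m differentiable (at p)"
  shows "transmission J G A B A B \<rho>v \<rho>w (\<lambda>p. \<Sum>m\<in>I. f m p) (\<lambda>p. \<Sum>m\<in>I. g m p)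
    (\<lambda>p. \<Sum>m\<in>I. v m p) (\<lambda>p. \<Sum>m\<in>I. w m p)"
  using assms(1,2,4-)
proof (induction I rule: finite_ne_induct)
  case (singleton m)
  then show ?case by simp
next
  case (insert m I)
  have "transmission J G A B A B \<rho>v \<rho>w (\<lambda>p. f m p + (\<Sum>m\<in>I. f m p)) (\<lambda>p. g m p + (\<Sum>m\<in>I. g m p))
    (\<lambda>p. v m p + (\<Sum>m\<in>I. v m p)) (\<lambda>p. w m p + (\<Sum>m\<in>I. w m p))"
    using insert \<open>A \<inter> B = {}\<close>
    by (intro transmission_add conjI differentiable_sum) auto
  then show ?case using insert by simp
qed

section \<open>Multiple scattering\<close>

lemma separated_connected_subset:
  assumes "open A" "open B" "A \<union> G \<union> B = UNIV" "A \<inter> B = {}"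
    and "connected S" "S \<inter> G = {}" "x \<in> S"
  shows "x \<in> A \<Longrightarrow> S \<subseteq> A" "x \<in> B \<Longrightarrow> S \<subseteq> B"
proof -
  have "A \<inter> S = {} \<or> B \<inter> S = {}"
    using assms by (intro connectedD) auto
  then show "x \<in> A \<Longrightarrow> S \<subseteq> A" "x \<in> B \<Longrightarrow> S \<subseteq> B"
    using assms by blast+
qed

lemma ball_setdist_disjoint:
  assumes "x \<in> S"
  shows "ball x (setdist S T) \<inter> T = {}"
  using setdist_le_dist[OF assms, of _ T] by (force simp: not_less[symmetric])

lemma three_layer_geometryD:
  assumes "three_layer_geometry \<Gamma> A B"
  shows "open (A 1)" "open (B 1)" "open (A 2)" "open (B 2)"
    "A 1 \<inter> B 1 = {}" "A 2 \<inter> B 2 = {}"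
    "\<Gamma> 2 \<subseteq> B 1" "\<Gamma> 1 \<subseteq> A 2" "A 1 \<union> \<Gamma> 1 \<union> B 1 = UNIV" "A 2 \<union> \<Gamma> 2 \<union> B 2 = UNIV"
  using assms by (simp_all add: three_layer_geometry_def lipschitz_interface_def del: One_nat_def)

text \<open>A ball of that radius around a point of one interface is connected and misses the other one, so
  it stays on one side.\<close>

lemma gap_balls:
  assumes geo: "three_layer_geometry \<Gamma> A B"
  shows "x \<in> \<Gamma> 1 \<Longrightarrow> ball x (setdist (\<Gamma> 1) (\<Gamma> 2)) \<subseteq> A 2"
    and "x \<in> \<Gamma> 2 \<Longrightarrow> ball x (setdist (\<Gamma> 1) (\<Gamma> 2)) \<subseteq> B 1"
proof -
  note g = three_layer_geometryD[OF geo]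
  show "ball x (setdist (\<Gamma> 1) (\<Gamma> 2)) \<subseteq> A 2" if "x \<in> \<Gamma> 1"
  proof (cases "setdist (\<Gamma> 1) (\<Gamma> 2) > 0")
    case True
    then show ?thesis
      using separated_connected_subset(1)[OF g(3,4,10,6) _ ball_setdist_disjoint[OF that, of "\<Gamma> 2"], of x] that g
      by auto
  qed (simp add: not_less ball_empty)
  show "ball x (setdist (\<Gamma> 1) (\<Gamma> 2)) \<subseteq> B 1" if "x \<in> \<Gamma> 2"
  proof (cases "setdist (\<Gamma> 2) (\<Gamma> 1) > 0")
    case True
    then show ?thesis
      using separated_connected_subset(2)[OF g(1,2,9,5) _ ball_setdist_disjoint[OF that, of "\<Gamma> 1"], of x] that g
      by (auto simp: setdist_sym)
  qed (simp add: not_less setdist_sym ball_empty)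
qed

lemma zero_solution_class: "function_class K \<Longrightarrow> (\<lambda>p. 0) \<in> K D"
  by (simp add: function_class_def)

lemma function_class_sum:
  assumes "function_class K" "\<And>m. m \<in> I \<Longrightarrow> u m \<in> K D"
  shows "(\<lambda>p. \<Sum>m\<in>I. u m p) \<in> K D"
  using assms(2)
  by (induction I rule: infinite_finite_induct)
    (use assms(1) in \<open>auto simp: function_class_def\<close>)

text \<open>Before time \<open>s\<close> the pair of zero fields solves the same problem, so uniqueness applies.\<close>

lemma two_layer_causality:
  assumes unique: "two_layer_unique K \<Gamma> A B c \<rho> j" and K: "function_class K"
    and sol: "two_layer_solution {0<..} \<Gamma> A B c \<rho> j f g v w" and in_K: "v \<in> K (A j)" "w \<in> K (B j)"
    and data: "\<And>x t. x \<in> \<Gamma> j \<Longrightarrow> 0 < t \<Longrightarrow> t < s \<Longrightarrow> f (x, t) = 0 \<and> g (x, t) = 0"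
    and t: "0 < t" "t < s"
  shows "x \<in> A j \<Longrightarrow> v (x, t) = 0" "x \<in> B j \<Longrightarrow> w (x, t) = 0"
proof -
  have J: "{0<..<s} \<subseteq> {0<..}" by auto
  have tr: "transmission {0<..<s} (\<Gamma> j) (A j) (B j) (A j) (B j) (\<rho> j) (\<rho> (j + 1)) f g v w"
    using sol unfolding two_layer_solution_def by (auto intro: transmission_cong[OF _ J])
  then have sol1: "two_layer_solution {0<..<s} \<Gamma> A B c \<rho> j f g v w"
    using sol unfolding two_layer_solution_def
    by (meson J order_refl wave_solution_subset zero_initial_subset)
  have sol0: "two_layer_solution {0<..<s} \<Gamma> A B c \<rho> j f g (\<lambda>p. 0) (\<lambda>p. 0)"
    using transmission_zero[OF tr] data unfolding two_layer_solution_def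
    by (simp add: wave_solution_zero zero_initial_zero)
  have "(\<forall>p\<in>A j \<times> {0<..<s}. v p = 0) \<and> (\<forall>p\<in>B j \<times> {0<..<s}. w p = 0)"
    using unique[unfolded two_layer_unique_def, rule_format, of s v "\<lambda>p. 0" w "\<lambda>p. 0" f g]
      in_K zero_solution_class[OF K] sol1 sol0 t by (metis order_less_trans)
  then show "x \<in> A j \<Longrightarrow> v (x, t) = 0" "x \<in> B j \<Longrightarrow> w (x, t) = 0"
    using t by auto
qed

text \<open>The conclusion on derivatives needs the field to vanish in a space-time neighbourhood of the
  point, and the cones for nearby points provide it.\<close>

lemma wave_zero_near:
  fixes u :: field
  assumes "open D" "wave_solution {0<..} D c u" "c > 0" "d > 0" "ball x d \<subseteq> D"
    and quiet: "\<And>y \<tau>. y \<in> D \<Longrightarrow> 0 < \<tau> \<Longrightarrow> \<tau> < s \<Longrightarrow> u (y, \<tau>) = 0"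
    and "s > 0" "0 < t" "t < s + d / c"
  shows "u (x, t) = 0" "dir_deriv e u (x, t) = 0"
proof -
  define W where "W = {p. 0 < snd p \<and> norm (fst p - x) + c * (snd p - s) < d \<and> norm (fst p - x) < d}"
  have "open W" unfolding W_def
    by (intro open_Collect_conj open_Collect_less continuous_intros)
  have "c * (t - s) < d" using assms(3,9) by (simp add: field_simps)
  then have "(x, t) \<in> W" using assms(4,8) by (simp add: W_def)
  moreover have zero: "u p = 0" if "p \<in> W" for p
  proof -
    obtain y \<tau> where p: "p = (y, \<tau>)" by (cases p)
    have y: "y \<in> D" "0 < \<tau>" "norm (y - x) + c * (\<tau> - s) < d"
      using that assms(5) by (auto simp: W_def p dist_norm norm_minus_commute subset_iff)
    show ?thesis
    proof (cases "\<tau> < s")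
      case True
      then show ?thesis using quiet y by (simp add: p)
    next
      case False
      \<comment> \<open>The field is known to vanish only for times below \<open>s\<close>, not at \<open>s\<close>, so the base of the cone is
        placed slightly earlier; the strict inequality for \<open>(y, \<tau>)\<close> allows a shift by up to \<open>\<eta>\<close>.\<close>
      define \<eta> where "\<eta> = (d - (norm (y - x) + c * (\<tau> - s))) / (2 * c)"
      have "\<eta> > 0" using y assms(3) by (simp add: \<eta>_def)
      define s' where "s' = max (s / 2) (s - \<eta>)"
      have s': "0 < s'" "s' < s" using \<open>\<eta> > 0\<close> \<open>s > 0\<close> by (auto simp: s'_def)
      have "c * (\<tau> - s') \<le> c * (\<tau> - (s - \<eta>))"
        using assms(3) by (intro mult_left_mono) (auto simp: s'_def)
      also have "\<dots> = c * (\<tau> - s) + c * \<eta>" by (simp add: algebra_simps)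
      also have "c * \<eta> = (d - (norm (y - x) + c * (\<tau> - s))) / 2"
        using assms(3) by (simp add: \<eta>_def)
      finally have "norm (y - x) + c * (\<tau> - s') < d" using y(3) by (simp add: field_simps)
      then show ?thesis unfolding p
        using assms(1-3,5) s' quiet False
        by (intro wave_vanishes_in_cone[of D c u s' x d y \<tau>]) auto
    qed
  qed
  ultimately show "u (x, t) = 0" "dir_deriv e u (x, t) = 0"
    using \<open>open W\<close> by (auto intro: dir_deriv_zero_open[of W])
qed

text \<open>The first sum has the form of the scattering data at an interface: given data in the first step
  and minus the field of the preceding step in all later ones.\<close>

lemma telescoping_sum:
  fixes a :: "'a::ab_group_add" and \<phi> :: "nat \<Rightarrow> 'a"
  assumes "M \<ge> 1"
  shows "(\<Sum>m=1..M. if m = 1 then a else - \<phi> (m - 1)) + (\<Sum>m=1..M. \<phi> m) = a + \<phi> M"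
  using assms by (induction M rule: dec_induct) (auto simp: algebra_simps)

lemma continuous_eq_at_endpoint:
  fixes u v :: field
  assumes "continuous_on (D \<times> {0<..}) u" "continuous_on (D \<times> {0<..}) v" "x \<in> D" "0 < T"
    and "\<And>t. 0 < t \<Longrightarrow> t < T \<Longrightarrow> u (x, t) = v (x, t)"
  shows "u (x, T) = v (x, T)"
proof -
  have lim: "((\<lambda>t. z (x, t)) \<longlongrightarrow> z (x, T)) (at_left T)" if "continuous_on (D \<times> {0<..}) z" for z :: field
  proof -
    have "continuous_on {0<..} (\<lambda>t. z (x, t))"
      using assms(3) by (intro continuous_on_compose2[OF that]) (auto intro!: continuous_intros)
    then have "isCont (\<lambda>t. z (x, t)) T"
      using assms(4) by (simp add: continuous_on_eq_continuous_at)
    then show ?thesis unfolding isCont_def by (rule filterlim_mono) (auto simp: at_le)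
  qed
  have "\<forall>\<^sub>F t in at_left T. u (x, t) = v (x, t)"
    using assms(4,5) by (intro eventually_at_leftI[of 0]) auto
  then have "((\<lambda>t. v (x, t)) \<longlongrightarrow> u (x, T)) (at_left T)"
    using lim[OF assms(1)] by (rule Lim_transform_eventually[rotated])
  then show ?thesis
    using tendsto_unique[OF _ _ lim[OF assms(2)]] by (simp add: trivial_limit_at_left_real)
qed

text \<open>The field of step \<open>m\<close> vanishes before time \<open>t0 + (m - 1) d / c\<^sub>2\<close>, and the part of it that enters
  the middle layer needs the further time \<open>d / c\<^sub>2\<close> to reach the other interface, where it
  produces the data of step \<open>m + 1\<close>.\<close>

lemma scattering_arrival_times:
  fixes c :: "nat \<Rightarrow> real"
  assumes geo: "three_layer_geometry \<Gamma> A B"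
    and d: "d = setdist (\<Gamma> 1) (\<Gamma> 2)" "d > 0" and c: "c 2 > 0" and t0: "t0 > 0"
    and K: "function_class K"
    and unique: "two_layer_unique K \<Gamma> A B c \<rho> 1" "two_layer_unique K \<Gamma> A B c \<rho> 2"
    and quiet: "\<And>j x t. j \<in> {1,2} \<Longrightarrow> x \<in> \<Gamma> j \<Longrightarrow> 0 < t \<Longrightarrow> t \<le> t0 \<Longrightarrow> f j (x, t) = 0 \<and> g j (x, t) = 0"
    and sol1: "\<And>m. m \<ge> 1 \<Longrightarrow> two_layer_solution {0<..} \<Gamma> A B c \<rho> 1
          (scatter_f f up um 1 m) (scatter_g A B \<rho> g up um 1 m) (up 1 m) (um 2 m)"
    and sol2: "\<And>m. m \<ge> 1 \<Longrightarrow> two_layer_solution {0<..} \<Gamma> A B c \<rho> 2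
          (scatter_f f up um 2 m) (scatter_g A B \<rho> g up um 2 m) (up 2 m) (um 3 m)"
    and in_K: "\<And>m. m \<ge> 1 \<Longrightarrow> up 1 m \<in> K (A 1) \<and> um 2 m \<in> K (B 1) \<and> up 2 m \<in> K (A 2) \<and> um 3 m \<in> K (B 2)"
    and m: "m \<ge> 1"
  defines "n \<equiv> \<lambda>j. unit_normal (A j) (B j)"
  shows "\<And>x t. x \<in> \<Gamma> 1 \<Longrightarrow> 0 < t \<Longrightarrow> t < t0 + real m * (d / c 2) \<Longrightarrow>
      up 2 m (x, t) = 0 \<and> normal_deriv (n 1) (up 2 m) (x, t) = 0"
    and "\<And>x t. x \<in> \<Gamma> 2 \<Longrightarrow> 0 < t \<Longrightarrow> t < t0 + real m * (d / c 2) \<Longrightarrow>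
      um 2 m (x, t) = 0 \<and> normal_deriv (n 2) (um 2 m) (x, t) = 0"
proof -
  note g = three_layer_geometryD[OF geo]
  have arrival: "(\<forall>x t. x \<in> \<Gamma> 1 \<longrightarrow> 0 < t \<longrightarrow> t < s + d / c 2 \<longrightarrow>
        up 2 m (x, t) = 0 \<and> normal_deriv (n 1) (up 2 m) (x, t) = 0) \<and>
      (\<forall>x t. x \<in> \<Gamma> 2 \<longrightarrow> 0 < t \<longrightarrow> t < s + d / c 2 \<longrightarrow>
        um 2 m (x, t) = 0 \<and> normal_deriv (n 2) (um 2 m) (x, t) = 0)"
    if m: "m \<ge> 1" and "s > 0"
      and data1: "\<And>x t. x \<in> \<Gamma> 1 \<Longrightarrow> 0 < t \<Longrightarrow> t < s \<Longrightarrow>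
        scatter_f f up um 1 m (x, t) = 0 \<and> scatter_g A B \<rho> g up um 1 m (x, t) = 0"
      and data2: "\<And>x t. x \<in> \<Gamma> 2 \<Longrightarrow> 0 < t \<Longrightarrow> t < s \<Longrightarrow>
        scatter_f f up um 2 m (x, t) = 0 \<and> scatter_g A B \<rho> g up um 2 m (x, t) = 0"
    for m s
  proof -
    have waves: "wave_solution {0<..} (A 2) (c 2) (up 2 m)" "wave_solution {0<..} (B 1) (c 2) (um 2 m)"
      using sol1[OF m] sol2[OF m] unfolding two_layer_solution_def one_add_one by blast+
    have up0: "up 2 m (y, \<tau>) = 0" if "y \<in> A 2" "0 < \<tau>" "\<tau> < s" for y \<tau>
      using two_layer_causality(1)[OF unique(2) K sol2[OF m]] in_K[OF m] data2 that by blast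
    have um0: "um 2 m (y, \<tau>) = 0" if "y \<in> B 1" "0 < \<tau>" "\<tau> < s" for y \<tau>
      using two_layer_causality(2)[OF unique(1) K sol1[OF m]] in_K[OF m] data1 that by blast
    show ?thesis
      using wave_zero_near[OF g(3) waves(1) c d(2) gap_balls(1)[OF geo, folded d(1)] up0 \<open>s > 0\<close>]
        wave_zero_near[OF g(2) waves(2) c d(2) gap_balls(2)[OF geo, folded d(1)] um0 \<open>s > 0\<close>]
      by (simp add: normal_deriv_def)
  qed
  have "(\<forall>x t. x \<in> \<Gamma> 1 \<longrightarrow> 0 < t \<longrightarrow> t < t0 + real m * (d / c 2) \<longrightarrow>
        up 2 m (x, t) = 0 \<and> normal_deriv (n 1) (up 2 m) (x, t) = 0) \<and>
      (\<forall>x t. x \<in> \<Gamma> 2 \<longrightarrow> 0 < t \<longrightarrow> t < t0 + real m * (d / c 2) \<longrightarrow>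
        um 2 m (x, t) = 0 \<and> normal_deriv (n 2) (um 2 m) (x, t) = 0)"
    using m
  proof (induction m rule: dec_induct)
    case base
    show ?case
      using arrival[of 1 t0] quiet t0 by (simp add: scatter_f_def scatter_g_def)
  next
    case (step m)
    have next_time: "t0 + real (Suc m) * (d / c 2) = (t0 + real m * (d / c 2)) + d / c 2"
      by (simp only: of_nat_Suc distrib_right mult_1_left add_ac)
    have pos: "t0 + real m * (d / c 2) > 0" using t0 c d(2) by (simp add: add_pos_nonneg)
    show ?case unfolding next_time
      using step.IH step.hyps
      by (intro arrival[of "Suc m"] pos) (auto simp: scatter_f_def scatter_g_def n_def)
  qed
  then show "\<And>x t. x \<in> \<Gamma> 1 \<Longrightarrow> 0 < t \<Longrightarrow> t < t0 + real m * (d / c 2) \<Longrightarrow>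
      up 2 m (x, t) = 0 \<and> normal_deriv (n 1) (up 2 m) (x, t) = 0"
    and "\<And>x t. x \<in> \<Gamma> 2 \<Longrightarrow> 0 < t \<Longrightarrow> t < t0 + real m * (d / c 2) \<Longrightarrow>
      um 2 m (x, t) = 0 \<and> normal_deriv (n 2) (um 2 m) (x, t) = 0"
    by blast+
qed

lemma normal_deriv_sum:
  assumes "finite I" "\<And>m. m \<in> I \<Longrightarrow> u m differentiable (at p)"
  shows "normal_deriv n (\<lambda>p. \<Sum>m\<in>I. u m p) p = (\<Sum>m\<in>I. normal_deriv n (u m) p)"
proof (cases p)
  case (Pair x t)
  have "((\<lambda>p. \<Sum>m\<in>I. u m p) has_derivative (\<lambda>e. \<Sum>m\<in>I. dir_deriv e (u m) p)) (at p)"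
    using assms by (intro has_derivative_sum has_derivative_dir_deriv)
  from dir_deriv_eq[OF this] show ?thesis by (simp add: normal_deriv_def Pair)
qed

text \<open>The middle layer receives the fields emitted by both interfaces. At an interface, the field of
  step \<open>m\<close> emitted by the other one is regular and adds its Cauchy data to the jumps. The data of step
  \<open>m + 1\<close> are the negatives of this contribution, so only that of the last step remains.\<close>

lemma scattering_sum_solution:
  fixes c \<rho> :: "nat \<Rightarrow> real"
  assumes geo: "three_layer_geometry \<Gamma> A B"
    and sol1: "\<And>m. m \<ge> 1 \<Longrightarrow> two_layer_solution {0<..} \<Gamma> A B c \<rho> 1
          (scatter_f f up um 1 m) (scatter_g A B \<rho> g up um 1 m) (up 1 m) (um 2 m)"
    and sol2: "\<And>m. m \<ge> 1 \<Longrightarrow> two_layer_solution {0<..} \<Gamma> A B c \<rho> 2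
          (scatter_f f up um 2 m) (scatter_g A B \<rho> g up um 2 m) (up 2 m) (um 3 m)"
    and M: "M \<ge> 1"
  defines "n \<equiv> \<lambda>j. unit_normal (A j) (B j)"
  shows "three_layer_solution {0<..} \<Gamma> A B c \<rho>
    (\<lambda>j p. if j = 1 then f 1 p + up 2 M p else f 2 p - um 2 M p)
    (\<lambda>j p. if j = 1 then g 1 p + normal_deriv (n 1) (up 2 M) p / \<rho> 2
       else g 2 p - normal_deriv (n 2) (um 2 M) p / \<rho> 2)
    (scattering_sum up um M)"
proof -
  let ?J = "{0::real<..}" and ?I = "{1..M}"
  note g = three_layer_geometryD[OF geo]
  have J: "open {(0::real)<..}" by simp
  have layers: "layer A B 1 = A 1" "layer A B 2 = B 1 \<inter> A 2" "layer A B 3 = B 2"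
    by (simp_all add: layer_def)
  have sums: "scattering_sum up um M 1 = (\<lambda>p. \<Sum>m\<in>?I. up 1 m p)"
    "scattering_sum up um M 2 = (\<lambda>p. (\<Sum>m\<in>?I. um 2 m p) + (\<Sum>m\<in>?I. up 2 m p))"
    "scattering_sum up um M 3 = (\<lambda>p. \<Sum>m\<in>?I. um 3 m p)"
    by (simp_all add: scattering_sum_def fun_eq_iff sum.distrib)
  have up1: "wave_solution {0<..} (A 1) (c 1) (up 1 m)" "zero_initial {0<..} (A 1) (up 1 m)"
    and um2: "wave_solution {0<..} (B 1) (c 2) (um 2 m)" "zero_initial {0<..} (B 1) (um 2 m)"
    and tr1: "transmission {0<..} (\<Gamma> 1) (A 1) (B 1) (A 1) (B 1) (\<rho> 1) (\<rho> 2)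
      (scatter_f f up um 1 m) (scatter_g A B \<rho> g up um 1 m) (up 1 m) (um 2 m)"
    if "m \<in> ?I" for m
    using sol1[of m] that unfolding two_layer_solution_def one_add_one by auto
  have "(2::nat) + 1 = 3" by simp
  then have up2: "wave_solution {0<..} (A 2) (c 2) (up 2 m)" "zero_initial {0<..} (A 2) (up 2 m)"
    and um3: "wave_solution {0<..} (B 2) (c 3) (um 3 m)" "zero_initial {0<..} (B 2) (um 3 m)"
    and tr2: "transmission {0<..} (\<Gamma> 2) (A 2) (B 2) (A 2) (B 2) (\<rho> 2) (\<rho> 3)
      (scatter_f f up um 2 m) (scatter_g A B \<rho> g up um 2 m) (up 2 m) (um 3 m)"
    if "m \<in> ?I" for m
    using sol2[of m] that unfolding two_layer_solution_def by auto
  have sum_waves: "wave_solution {0<..} (A 1) (c 1) (\<lambda>p. \<Sum>m\<in>?I. up 1 m p)"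
      "wave_solution {0<..} (B 1) (c 2) (\<lambda>p. \<Sum>m\<in>?I. um 2 m p)"
      "wave_solution {0<..} (A 2) (c 2) (\<lambda>p. \<Sum>m\<in>?I. up 2 m p)"
      "wave_solution {0<..} (B 2) (c 3) (\<lambda>p. \<Sum>m\<in>?I. um 3 m p)"
    by (rule wave_solution_sum; use g J up1 um2 up2 um3 in blast)+
  have sum_initial: "zero_initial {0<..} (A 1) (\<lambda>p. \<Sum>m\<in>?I. up 1 m p)"
      "zero_initial {0<..} (B 1) (\<lambda>p. \<Sum>m\<in>?I. um 2 m p)"
      "zero_initial {0<..} (A 2) (\<lambda>p. \<Sum>m\<in>?I. up 2 m p)"
      "zero_initial {0<..} (B 2) (\<lambda>p. \<Sum>m\<in>?I. um 3 m p)"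
    by (rule zero_initial_sum; use up1 um2 up2 um3 in blast)+
  have waves: "\<forall>j\<in>{1,2,3}. wave_solution {0<..} (layer A B j) (c j) (scattering_sum up um M j) \<and>
      zero_initial {0<..} (layer A B j) (scattering_sum up um M j)"
  proof -
    have "wave_solution {0<..} (B 1 \<inter> A 2) (c 2) (scattering_sum up um M 2)"
      unfolding sums
      by (intro wave_solution_add open_Int g J wave_solution_subset[OF sum_waves(2)]
          wave_solution_subset[OF sum_waves(3)] order_refl Int_lower1 Int_lower2)
    moreover have "zero_initial {0<..} (B 1 \<inter> A 2) (scattering_sum up um M 2)"
      unfolding sums
      by (intro zero_initial_add zero_initial_subset[OF sum_initial(2)]
          zero_initial_subset[OF sum_initial(3)] order_refl Int_lower1 Int_lower2)
    ultimately show ?thesis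
      using sum_waves sum_initial by (simp add: layers sums del: One_nat_def)
  qed
  have C1: "C_diff_on 1 (D \<times> J) u" if "wave_solution J D c' u" for D J c' u
    using that C_diff_on_pred[of 1 "D \<times> J" u]
    by (simp add: wave_solution_def numeral_2_eq_2 del: C_diff_on.simps)
  have diff: "u differentiable (at p)" if "wave_solution J D c' u" "p \<in> D \<times> J" for D J c' u p
    using C1[OF that(1)] that(2) by auto
  have zero: "C_diff_on 1 S (\<lambda>p. 0)" "normal_deriv n' (\<lambda>p. 0) = (\<lambda>p. 0)"
    for S :: "(plane \<times> real) set" and n'
    by (auto simp: C_diff_on_const normal_deriv_def fun_eq_iff dir_deriv_eq[OF has_derivative_const]
        simp del: C_diff_on.simps)
  have nonempty: "?I \<noteq> {}" using M by simp
  have "transmission {0<..} (\<Gamma> 1) (A 1) (B 1) (A 1) (B 1 \<inter> A 2) (\<rho> 1) (\<rho> 2)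
    (\<lambda>p. (\<Sum>m\<in>?I. scatter_f f up um 1 m p) + (\<Sum>m\<in>?I. up 2 m p) - 0)
    (\<lambda>p. (\<Sum>m\<in>?I. scatter_g A B \<rho> g up um 1 m p)
       + normal_deriv (n 1) (\<lambda>p. \<Sum>m\<in>?I. up 2 m p) p / \<rho> 2 - normal_deriv (n 1) (\<lambda>p. 0) p / \<rho> 1)
    (\<lambda>p. (\<Sum>m\<in>?I. up 1 m p) + 0) (\<lambda>p. (\<Sum>m\<in>?I. um 2 m p) + (\<Sum>m\<in>?I. up 2 m p))"
    unfolding n_def
    by (intro transmission_add_regular[where U = "A 2"] transmission_sum tr1 nonempty g J
        zero C1[OF sum_waves(3)] diff[OF sum_waves(1)] diff[OF sum_waves(2)]
        diff[OF up1(1)] diff[OF um2(1)] finite_atLeastAtMost order_refl Int_lower1)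
  then have T1: "transmission {0<..} (\<Gamma> 1) (A 1) (B 1) (A 1) (B 1 \<inter> A 2) (\<rho> 1) (\<rho> 2)
    (\<lambda>p. f 1 p + up 2 M p) (\<lambda>p. g 1 p + normal_deriv (n 1) (up 2 M) p / \<rho> 2)
    (scattering_sum up um M 1) (scattering_sum up um M 2)"
    unfolding sums add_0_right
  proof (rule transmission_cong)
    fix x t assume xt: "x \<in> \<Gamma> 1" "t \<in> ?J"
    have f: "(\<Sum>m\<in>?I. scatter_f f up um 1 m (x, t)) = (\<Sum>m\<in>?I. if m = 1 then f 1 (x, t) else - up 2 (m - 1) (x, t))"
      by (rule sum.cong) (auto simp: scatter_f_def)
    have g': "(\<Sum>m\<in>?I. scatter_g A B \<rho> g up um 1 m (x, t))
        = (\<Sum>m\<in>?I. if m = 1 then g 1 (x, t) else - (normal_deriv (n 1) (up 2 (m - 1)) (x, t) / \<rho> 2))"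
      by (rule sum.cong) (auto simp: scatter_g_def n_def)
    have "(x, t) \<in> A 2 \<times> ?J" using xt g(8) by auto
    then have "normal_deriv (n 1) (\<lambda>p. \<Sum>m\<in>?I. up 2 m p) (x, t) / \<rho> 2
        = (\<Sum>m\<in>?I. normal_deriv (n 1) (up 2 m) (x, t) / \<rho> 2)"
      by (subst normal_deriv_sum) (auto intro: diff[OF up2(1)] simp: sum_divide_distrib)
    then show "f 1 (x, t) + up 2 M (x, t) =
        (\<Sum>m\<in>?I. scatter_f f up um 1 m (x, t)) + (\<Sum>m\<in>?I. up 2 m (x, t)) - 0 \<and>
      g 1 (x, t) + normal_deriv (n 1) (up 2 M) (x, t) / \<rho> 2 =
        (\<Sum>m\<in>?I. scatter_g A B \<rho> g up um 1 m (x, t))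
       + normal_deriv (n 1) (\<lambda>p. \<Sum>m\<in>?I. up 2 m p) (x, t) / \<rho> 2 - normal_deriv (n 1) (\<lambda>p. 0) (x, t) / \<rho> 1"
      using telescoping_sum[OF M, of "f 1 (x, t)" "\<lambda>m. up 2 m (x, t)"]
        telescoping_sum[OF M, of "g 1 (x, t)" "\<lambda>m. normal_deriv (n 1) (up 2 m) (x, t) / \<rho> 2"]
      unfolding f g' zero by simp
  qed simp
  have "transmission {0<..} (\<Gamma> 2) (A 2) (B 2) (B 1 \<inter> A 2) (B 2) (\<rho> 2) (\<rho> 3)
    (\<lambda>p. (\<Sum>m\<in>?I. scatter_f f up um 2 m p) + 0 - (\<Sum>m\<in>?I. um 2 m p))
    (\<lambda>p. (\<Sum>m\<in>?I. scatter_g A B \<rho> g up um 2 m p)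
       + normal_deriv (n 2) (\<lambda>p. 0) p / \<rho> 3 - normal_deriv (n 2) (\<lambda>p. \<Sum>m\<in>?I. um 2 m p) p / \<rho> 2)
    (\<lambda>p. (\<Sum>m\<in>?I. up 2 m p) + (\<Sum>m\<in>?I. um 2 m p)) (\<lambda>p. (\<Sum>m\<in>?I. um 3 m p) + 0)"
    unfolding n_def
    by (intro transmission_add_regular[where U = "B 1"] transmission_sum tr2 nonempty g J
        zero C1[OF sum_waves(2)] diff[OF sum_waves(3)] diff[OF sum_waves(4)]
        diff[OF up2(1)] diff[OF um3(1)] finite_atLeastAtMost order_refl Int_lower2)
  then have T2: "transmission {0<..} (\<Gamma> 2) (A 2) (B 2) (B 1 \<inter> A 2) (B 2) (\<rho> 2) (\<rho> 3)
    (\<lambda>p. f 2 p - um 2 M p) (\<lambda>p. g 2 p - normal_deriv (n 2) (um 2 M) p / \<rho> 2)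
    (scattering_sum up um M 2) (scattering_sum up um M 3)"
    unfolding sums add_0_right add.commute[of "\<Sum>m\<in>?I. up 2 m _"]
  proof (rule transmission_cong)
    fix x t assume xt: "x \<in> \<Gamma> 2" "t \<in> ?J"
    \<comment> \<open>The field \<open>um 2 m\<close> lies above the lower interface and is subtracted in the jump there, hence the
      double sign.\<close>
    have f: "(\<Sum>m\<in>?I. scatter_f f up um 2 m (x, t)) = (\<Sum>m\<in>?I. if m = 1 then f 2 (x, t) else - (- um 2 (m - 1) (x, t)))"
      by (rule sum.cong) (auto simp: scatter_f_def)
    have g': "(\<Sum>m\<in>?I. scatter_g A B \<rho> g up um 2 m (x, t))
        = (\<Sum>m\<in>?I. if m = 1 then g 2 (x, t) else - (- (normal_deriv (n 2) (um 2 (m - 1)) (x, t) / \<rho> 2)))"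
      by (rule sum.cong) (auto simp: scatter_g_def n_def)
    have "(x, t) \<in> B 1 \<times> ?J" using xt g(7) by auto
    then have "normal_deriv (n 2) (\<lambda>p. \<Sum>m\<in>?I. um 2 m p) (x, t) / \<rho> 2
        = (\<Sum>m\<in>?I. normal_deriv (n 2) (um 2 m) (x, t) / \<rho> 2)"
      by (subst normal_deriv_sum) (auto intro: diff[OF um2(1)] simp: sum_divide_distrib)
    then show "f 2 (x, t) - um 2 M (x, t) =
        (\<Sum>m\<in>?I. scatter_f f up um 2 m (x, t)) - (\<Sum>m\<in>?I. um 2 m (x, t)) \<and>
      g 2 (x, t) - normal_deriv (n 2) (um 2 M) (x, t) / \<rho> 2 =
        (\<Sum>m\<in>?I. scatter_g A B \<rho> g up um 2 m (x, t))
       + normal_deriv (n 2) (\<lambda>p. 0) (x, t) / \<rho> 3 - normal_deriv (n 2) (\<lambda>p. \<Sum>m\<in>?I. um 2 m p) (x, t) / \<rho> 2"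
      using telescoping_sum[OF M, of "f 2 (x, t)" "\<lambda>m. - um 2 m (x, t)"]
        telescoping_sum[OF M, of "g 2 (x, t)" "\<lambda>m. - (normal_deriv (n 2) (um 2 m) (x, t) / \<rho> 2)"]
      unfolding f g' zero by (simp add: sum_negf)
  qed simp
  show ?thesis
    unfolding three_layer_solution_def
    using waves T1 T2 \<open>(2::nat) + 1 = 3\<close> by (simp add: layers one_add_one del: One_nat_def)
qed

theorem theorem3p4:
  fixes \<Gamma> A B :: "nat \<Rightarrow> plane set"
    and c \<rho> :: "nat \<Rightarrow> real"
    and K :: "plane set \<Rightarrow> field set"
    and f g u :: "nat \<Rightarrow> field"
    and up um :: "nat \<Rightarrow> nat \<Rightarrow> field"
    and t0 d T :: real and M :: nat
  assumes "three_layer_geometry \<Gamma> A B"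
    and "d = setdist (\<Gamma> 1) (\<Gamma> 2)" and "d > 0"
    and "\<forall>j\<in>{1,2,3}. c j > 0 \<and> \<rho> j > 0"
    and "t0 > 0"
    and "function_class K"
    and "three_layer_unique K \<Gamma> A B c \<rho>"
    and "\<forall>j\<in>{1,2}. two_layer_unique K \<Gamma> A B c \<rho> j"
    and "plane_wave_data \<Gamma> A B c \<rho> f g \<or> point_source_data \<Gamma> A B c \<rho> f g"
    and "\<forall>j\<in>{1,2}. \<forall>x\<in>\<Gamma> j. \<forall>t. 0 < t \<and> t \<le> t0 \<longrightarrow> f j (x, t) = 0 \<and> g j (x, t) = 0"
    and "\<forall>j\<in>{1,2,3}. u j \<in> K (layer A B j)"
    and "three_layer_solution {0<..} \<Gamma> A B c \<rho> f g u"
    and "multiple_scattering K \<Gamma> A B c \<rho> f g up um"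
    and "M \<ge> 2"
    and "T = t0 + d / c 2 * real M"
  shows "\<forall>j\<in>{1,2,3}. \<forall>x\<in>layer A B j. \<forall>t\<in>{0..T}.
           u j (x, t) = scattering_sum up um M j (x, t)"
proof -
  note geo = assms(1) and d = assms(2,3) and coeff = assms(4) and t0 = assms(5) and K = assms(6)
    and unique3 = assms(7) and unique2 = assms(8) and quiet = assms(10)
    and u_in_K = assms(11) and u_sol = assms(12) and scat = assms(13) and T_def = assms(15)
  have c2: "c 2 > 0" using coeff by simp
  have M: "M \<ge> 1" using assms(14) by simp
  have sol: "two_layer_solution {0<..} \<Gamma> A B c \<rho> j
          (scatter_f f up um j m) (scatter_g A B \<rho> g up um j m) (up j m) (um (j + 1) m)"
    and in_K: "up j m \<in> K (A j)" "um (j + 1) m \<in> K (B j)" if "m \<ge> 1" "j \<in> {1,2}" for j m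
    using scat that unfolding multiple_scattering_def by blast+
  have sol1: "two_layer_solution {0<..} \<Gamma> A B c \<rho> 1
          (scatter_f f up um 1 m) (scatter_g A B \<rho> g up um 1 m) (up 1 m) (um 2 m)"
    if "m \<ge> 1" for m
    using sol[OF that, of 1] by (simp add: one_add_one del: One_nat_def)
  have sol2: "two_layer_solution {0<..} \<Gamma> A B c \<rho> 2
          (scatter_f f up um 2 m) (scatter_g A B \<rho> g up um 2 m) (up 2 m) (um 3 m)"
    if "m \<ge> 1" for m
    using sol[OF that, of 2] by simp
  have in_K': "up 1 m \<in> K (A 1) \<and> um 2 m \<in> K (B 1) \<and> up 2 m \<in> K (A 2) \<and> um 3 m \<in> K (B 2)"
    if "m \<ge> 1" for m
    using in_K[OF that, of 1] in_K[OF that, of 2] by (simp add: one_add_one del: One_nat_def)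
  have unique1': "two_layer_unique K \<Gamma> A B c \<rho> 1" and unique2': "two_layer_unique K \<Gamma> A B c \<rho> 2"
    using unique2 by simp_all
  have T: "T = t0 + real M * (d / c 2)" unfolding T_def by simp
  have "T > 0" using T t0 c2 d by (simp add: add_pos_nonneg)
  have quiet': "f j (x, t) = 0 \<and> g j (x, t) = 0" if "j \<in> {1,2}" "x \<in> \<Gamma> j" "0 < t" "t \<le> t0" for j x t
    using quiet that by blast
  note arrival = scattering_arrival_times[OF geo d c2 t0 K unique1' unique2' quiet' sol1 sol2 in_K' M,
      folded T]
  let ?s = "scattering_sum up um M"
  have J: "{0<..<T} \<subseteq> {0<..}" by auto
  have restrict: "three_layer_solution {0<..<T} \<Gamma> A B c \<rho> f g w"
    if w: "three_layer_solution {0<..} \<Gamma> A B c \<rho> f' g' w"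
      and data: "\<And>j x t. j \<in> {1,2} \<Longrightarrow> x \<in> \<Gamma> j \<Longrightarrow> t \<in> {0<..<T} \<Longrightarrow>
        f j (x, t) = f' j (x, t) \<and> g j (x, t) = g' j (x, t)" for f' g' w
    unfolding three_layer_solution_def
  proof (intro conjI ballI)
    fix j :: nat assume j: "j \<in> {1,2,3}"
    show "wave_solution {0<..<T} (layer A B j) (c j) (w j)" "zero_initial {0<..<T} (layer A B j) (w j)"
      using w j J unfolding three_layer_solution_def
      by (blast intro: wave_solution_subset zero_initial_subset)+
  next
    fix j :: nat assume j: "j \<in> {1,2}"
    have "transmission {0<..} (\<Gamma> j) (A j) (B j) (layer A B j) (layer A B (j + 1))
        (\<rho> j) (\<rho> (j + 1)) (f' j) (g' j) (w j) (w (j + 1))"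
      using w j unfolding three_layer_solution_def by blast
    then show "transmission {0<..<T} (\<Gamma> j) (A j) (B j) (layer A B j) (layer A B (j + 1))
        (\<rho> j) (\<rho> (j + 1)) (f j) (g j) (w j) (w (j + 1))"
      using J data[OF j] by (rule transmission_cong)
  qed
  have s_sol: "three_layer_solution {0<..} \<Gamma> A B c \<rho>
    (\<lambda>j p. if j = 1 then f 1 p + up 2 M p else f 2 p - um 2 M p)
    (\<lambda>j p. if j = 1 then g 1 p + normal_deriv (unit_normal (A 1) (B 1)) (up 2 M) p / \<rho> 2
       else g 2 p - normal_deriv (unit_normal (A 2) (B 2)) (um 2 M) p / \<rho> 2) ?s"
    by (rule scattering_sum_solution[OF geo sol1 sol2 M])
  have s_sol_T: "three_layer_solution {0<..<T} \<Gamma> A B c \<rho> f g ?s"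
  proof (rule restrict[OF s_sol])
    fix j :: nat and x t assume "j \<in> {1,2}" "x \<in> \<Gamma> j" "t \<in> {0<..<T}"
    then show "f j (x, t) = (if j = 1 then f 1 (x, t) + up 2 M (x, t) else f 2 (x, t) - um 2 M (x, t)) \<and>
      g j (x, t) = (if j = 1 then g 1 (x, t) + normal_deriv (unit_normal (A 1) (B 1)) (up 2 M) (x, t) / \<rho> 2
       else g 2 (x, t) - normal_deriv (unit_normal (A 2) (B 2)) (um 2 M) (x, t) / \<rho> 2)"
      using arrival quiet by auto
  qed
  have s_in_K: "?s j \<in> K (layer A B j)" if "j \<in> {1,2,3}" for j
  proof -
    have K_add: "(\<lambda>p. v p + w p) \<in> K D" if "v \<in> K D" "w \<in> K D" for v w D
      using K that by (simp add: function_class_def)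
    have K_mono: "w \<in> K D'" if "w \<in> K D" "D' \<subseteq> D" for w D D'
    proof -
      have "K D \<subseteq> K D'" using K that(2) by (simp add: function_class_def)
      then show ?thesis using that(1) by (rule subsetD)
    qed
    have "?s 1 \<in> K (A 1)" "?s 3 \<in> K (B 2)" "?s 2 \<in> K (B 1 \<inter> A 2)"
    proof -
      have "(\<lambda>p. \<Sum>m=1..M. up 1 m p) \<in> K (A 1)" "(\<lambda>p. \<Sum>m=1..M. um 3 m p) \<in> K (B 2)"
        using in_K' by (auto intro!: function_class_sum[OF K])
      then show "?s 1 \<in> K (A 1)" "?s 3 \<in> K (B 2)"
        by (simp_all add: scattering_sum_def[abs_def])
      have "(\<lambda>p. um 2 m p + up 2 m p) \<in> K (B 1 \<inter> A 2)" if "m \<ge> 1" for m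
        using in_K'[OF that] K_mono by (intro K_add) (meson Int_lower1 Int_lower2)+
      then have "(\<lambda>p. \<Sum>m=1..M. um 2 m p + up 2 m p) \<in> K (B 1 \<inter> A 2)"
        by (intro function_class_sum[OF K]) simp
      then show "?s 2 \<in> K (B 1 \<inter> A 2)" by (simp add: scattering_sum_def[abs_def])
    qed
    then show ?thesis using that by (auto simp: layer_def)
  qed
  have u_sol_T: "three_layer_solution {0<..<T} \<Gamma> A B c \<rho> f g u"
    by (rule restrict[OF u_sol]) simp
  have eq: "u j (x, t) = ?s j (x, t)" if "j \<in> {1,2,3}" "x \<in> layer A B j" "t \<in> {0<..<T}" for j x t
    using unique3[unfolded three_layer_unique_def, rule_format, OF \<open>T > 0\<close> _ u_sol_T s_sol_T, of j "(x, t)"]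
      that u_in_K s_in_K by blast
  show ?thesis
  proof (intro ballI)
    fix j :: nat and x t assume j: "j \<in> {1,2,3}" and x: "x \<in> layer A B j" and t: "t \<in> {0..T}"
    consider "t = 0" | "t \<in> {0<..<T}" | "t = T" using t by fastforce
    then show "u j (x, t) = ?s j (x, t)"
    proof cases
      case 1
      have "zero_initial {0<..} (layer A B j) (u j)" "zero_initial {0<..} (layer A B j) (?s j)"
        using u_sol s_sol j unfolding three_layer_solution_def by blast+
      then show ?thesis using x 1 by (simp add: zero_initial_def)
    next
      case 2
      then show ?thesis using eq j x by blast
    next
      case 3
      have "wave_solution {0<..} (layer A B j) (c j) (u j)" "wave_solution {0<..} (layer A B j) (c j) (?s j)"
        using u_sol s_sol j unfolding three_layer_solution_def by blast+
      then have "continuous_on (layer A B j \<times> {0<..}) (u j)" "continuous_on (layer A B j \<times> {0<..}) (?s j)"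
        by (auto simp: wave_solution_def intro: C_diff_on_continuous)
      then show ?thesis unfolding 3
        by (rule continuous_eq_at_endpoint[OF _ _ x \<open>T > 0\<close>]) (use eq[OF j x] in simp)
    qed
  qed
qed

end
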